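(* Let $L$ be a complete, meet-continuous modular lattice. If $x\prec y$ is a covering in $L$ such that $\upsilon[x\prec y]$ is finite, then the covering $\mathrm{Fg}\{x\}\prec\mathrm{Fg}\{y\}$ is regular in $\mathrm{Fil}\,L$, with multiplicity equal to $\upsilon[x\prec y]$.
   Context: A covering $x\prec y$ in a lattice is a pair $x<y$ with no element strictly between. For pairs with $x\le y$, $z\le w$, write $\langle x,y\rangle\nearrow\langle z,w\rangle$ if $y\wedge z=x$ and $y\vee z=w$; projective equivalence $\sim$ is the symmetric and transitive closure of $\nearrow$. A complete lattice $L$ is meet-continuous if $a\wedge\bigvee D=\bigvee_{d\in D}(a\wedge d)$ for all $a\in L$ and all upward directed $D\subseteq L$. For a chain $C$ in a modular lattice $M$ and a covering $x\prec y$ of $M$, $\mu_C[x\prec y]$ is the cardinality of the set of coverings $u\prec v$ of $M$ with $u,v\in C$ and $\langle u,v\rangle\sim\langle x,y\rangle$. The multiplicity upper bound $\upsilon[x\prec y]$ of $x\prec y$ in $M$ is defined as the least cardinal number $\nu$ such that $\mu_C[x\prec y]<\nu$ for every chain $C$ in $M$. A covering $x\prec y$ in a complete modular lattice is upper regular if for every nonempty chain $I$ and every family of coverings $x_i\prec y_i$ ($i\in I$), each projectively equivalent to $x\prec y$ and such that $i<j$ implies $\langle x_i,y_i\rangle\nearrow\langle x_j,y_j\rangle$, we have $\bigvee_i x_i\prec\bigvee_i y_i$. Lower regular is the dual; regular means both. It is known (previous work) that if $x\prec y$ is regular in a complete modular lattice, then $\mu_C[x\prec y]$ is the same cardinal for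 all maximal chains $C$; this common value is the multiplicity $\mu[x\prec y]$. A filter of $L$ is a nonempty up-closed subset closed under binary meets. $\mathrm{Fil}\,L$ is the lattice of filters ordered by reverse inclusion ($F\le G$ iff $G\subseteq F$); it is complete and modular when $L$ is. $\mathrm{Fg}\{x\}=\{z\in L: z\ge x\}$; $x\prec y$ in $L$ implies $\mathrm{Fg}\{x\}\prec\mathrm{Fg}\{y\}$ in $\mathrm{Fil}\,L$.
   Formalization: The multiplicity upper bound is taken as the least ν with μ_C ≤ ν (not μ_C < ν) for every chain C; with the strict bound the claim is false: for L = {0,1} it gives υ = 2 while the multiplicity in Fil L is 1. *)

theory Defs
  imports Main
begin

unbundle lattice_syntax
unbundle cardinal_syntax

section \<open>Modular and meet-continuous lattices\<close>

class modular_lattice = lattice +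
  assumes modular_law: "x \<le> z \<Longrightarrow> x \<squnion> (y \<sqinter> z) = (x \<squnion> y) \<sqinter> z"

class meet_continuous_lattice = complete_lattice +
  assumes meet_continuous:
    "D \<noteq> {} \<Longrightarrow> (\<And>d e. d \<in> D \<Longrightarrow> e \<in> D \<Longrightarrow> \<exists>f\<in>D. d \<le> f \<and> e \<le> f)
      \<Longrightarrow> a \<sqinter> \<Squnion>D = (\<Squnion>d\<in>D. a \<sqinter> d)"


section \<open>Coverings, projective equivalence and multiplicities\<close>

definition covering :: "'a::order \<Rightarrow> 'a \<Rightarrow> bool"  (infix \<open>\<prec>\<close> 50) where
  "x \<prec> y \<longleftrightarrow> x < y \<and> \<not> (\<exists>z. x < z \<and> z < y)"

definition transposes_up :: "'a::lattice \<times> 'a \<Rightarrow> 'a \<times> 'a \<Rightarrow> bool"  (infix \<open>\<nearrow>\<close> 50) where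
  "p \<nearrow> q \<longleftrightarrow> (case (p, q) of ((x, y), (z, w)) \<Rightarrow>
     x \<le> y \<and> z \<le> w \<and> y \<sqinter> z = x \<and> y \<squnion> z = w)"

definition projective :: "'a::lattice \<times> 'a \<Rightarrow> 'a \<times> 'a \<Rightarrow> bool"  (infix \<open>\<approx>\<close> 50) where
  "projective = (symclp (\<nearrow>))\<^sup>+\<^sup>+"

abbreviation is_chain :: "'a::order set \<Rightarrow> bool" where
  "is_chain \<equiv> pred_on.chain UNIV (\<le>)"

abbreviation is_maximal_chain :: "'a::order set \<Rightarrow> bool" where
  "is_maximal_chain \<equiv> pred_on.maxchain UNIV (\<le>)"

definition coverings_in :: "'a::lattice set \<Rightarrow> 'a \<Rightarrow> 'a \<Rightarrow> ('a \<times> 'a) set" where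
  "coverings_in C x y = {(u, v). u \<in> C \<and> v \<in> C \<and> u \<prec> v \<and> (u, v) \<approx> (x, y)}"

text \<open>Cardinal numbers are represented by cardinal orders (\<^const>\<open>Card_order\<close>), compared
  by \<open>\<le>o\<close> and identified up to \<open>=o\<close>.\<close>

definition chain_mult :: "'a::lattice set \<Rightarrow> 'a \<Rightarrow> 'a \<Rightarrow> ('a \<times> 'a) rel" where
  "chain_mult C x y = |coverings_in C x y|"

definition bounds_mult :: "'b rel \<Rightarrow> 'a::lattice \<Rightarrow> 'a \<Rightarrow> bool" where
  "bounds_mult \<nu> x y \<longleftrightarrow> Card_order \<nu> \<and> (\<forall>C. is_chain C \<longrightarrow> chain_mult C x y \<le>o \<nu>)"

text \<open>The least cardinal bounding the multiplicities in all chains. The bound is non-strict: if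
  \<open><o\<close> were used instead, this would be 2 for the unique covering of the two-element lattice,
  whose multiplicity is 1. A cardinal order on a subset of \<open>'a\<close> always suffices, and it is least
  among cardinal orders on any type: see \<open>mult_upper_bound_bounds\<close> and
  \<open>mult_upper_bound_least\<close> below.\<close>

definition mult_upper_bound :: "'a::lattice \<Rightarrow> 'a \<Rightarrow> 'a rel" where
  "mult_upper_bound x y = (SOME \<nu>. bounds_mult \<nu> x y \<and>
     (\<forall>\<nu>'::'a rel. bounds_mult \<nu>' x y \<longrightarrow> \<nu> \<le>o \<nu>'))"

definition has_multiplicity :: "'a::lattice \<Rightarrow> 'a \<Rightarrow> 'b rel \<Rightarrow> bool" where
  "has_multiplicity x y \<kappa> \<longleftrightarrow> (\<forall>C. is_maximal_chain C \<longrightarrow> chain_mult C x y =o \<kappa>)"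

lemma chain_mult_le_UNIV:
  fixes C :: "'a::lattice set"
  assumes "is_chain C"
  shows "chain_mult C x y \<le>o |UNIV :: 'a set|"
proof -
  have lin: "u \<le> v \<or> v \<le> u" if "u \<in> C" "v \<in> C" for u v
    using assms that by (auto simp: pred_on.chain_def)
  have "inj_on fst (coverings_in C x y)"
  proof (rule inj_onI)
    fix p q assume p: "p \<in> coverings_in C x y" and q: "q \<in> coverings_in C x y"
      and eq: "fst p = fst q"
    obtain u v w where pq: "p = (u, v)" "q = (u, w)"
      using eq by (metis prod.collapse)
    have "v \<in> C" "w \<in> C" "u \<prec> v" "u \<prec> w"
      using p q by (auto simp: pq coverings_in_def)
    then have "v = w"
      using lin[of v w] unfolding covering_def by (metis order_le_imp_less_or_eq)
    then show "p = q" by (simp add: pq)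
  qed
  then show ?thesis
    unfolding chain_mult_def using card_of_ordLeq by blast
qed

lemma mult_upper_bound_exists:
  fixes x y :: "'a::lattice"
  shows "\<exists>\<nu>::'a rel. bounds_mult \<nu> x y \<and> (\<forall>\<nu>'::'a rel. bounds_mult \<nu>' x y \<longrightarrow> \<nu> \<le>o \<nu>')"
proof -
  let ?R = "{\<nu>::'a rel. bounds_mult \<nu> x y}"
  have "|UNIV :: 'a set| \<in> ?R"
    by (auto simp: bounds_mult_def chain_mult_le_UNIV card_of_Card_order)
  then have "?R \<noteq> {}" by blast
  moreover have "\<forall>r\<in>?R. Well_order r"
    by (auto simp: bounds_mult_def card_order_on_def)
  ultimately show ?thesis
    using exists_minim_Well_order[of ?R] by auto
qed

lemma mult_upper_bound_bounds: "bounds_mult (mult_upper_bound x y) x y"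
  using someI_ex[OF mult_upper_bound_exists[of x y]] unfolding mult_upper_bound_def by blast

lemma mult_upper_bound_least:
  fixes x y :: "'a::lattice" and \<nu> :: "'b rel"
  assumes "bounds_mult \<nu> x y"
  shows "mult_upper_bound x y \<le>o \<nu>"
proof (rule ccontr)
  let ?m = "mult_upper_bound x y"
  assume neg: "\<not> ?m \<le>o \<nu>"
  have co: "Card_order \<nu>" "Card_order ?m"
    using assms mult_upper_bound_bounds[of x y] by (auto simp: bounds_mult_def)
  then have "\<nu> <o ?m"
    using neg by (auto simp: card_order_on_def not_ordLeq_iff_ordLess)
  then have "|Field \<nu>| \<le>o |Field ?m|"
    using card_of_mono2 ordLess_imp_ordLeq by blast
  then obtain f where f: "inj_on f (Field \<nu>)" "f ` Field \<nu> \<subseteq> Field ?m"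
    unfolding card_of_ordLeq[symmetric] by blast
  have "|Field \<nu>| =o |f ` Field \<nu>|"
    using f(1) card_of_ordIsoI[of f] by (simp add: bij_betw_def)
  then have iso: "\<nu> =o |f ` Field \<nu>|"
    using co(1) by (metis card_of_Field_ordIso ordIso_symmetric ordIso_transitive)
  then have "bounds_mult |f ` Field \<nu>| x y"
    using assms unfolding bounds_mult_def
    by (auto intro: ordLeq_ordIso_trans card_of_Card_order)
  then have "?m \<le>o |f ` Field \<nu>|"
    using someI_ex[OF mult_upper_bound_exists[of x y]] unfolding mult_upper_bound_def by blast
  then show False
    using neg iso by (meson ordIso_symmetric ordLeq_ordIso_trans)
qed


section \<open>Regular coverings\<close>

text \<open>Index chains are subsets of \<open>'a \<times> 'a\<close> with an arbitrary linear order \<open>r\<close>. This covers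
  chains of any type, since two indices \<open>i < j\<close> with \<open>u i = u j\<close> also have \<open>v i = v j\<close>:
  see \<open>upper_regularD\<close> and \<open>lower_regularD\<close>.\<close>

definition upper_regular :: "'a::{complete_lattice, modular_lattice} \<Rightarrow> 'a \<Rightarrow> bool" where
  "upper_regular x y \<longleftrightarrow> x \<prec> y \<and>
    (\<forall>(I :: ('a \<times> 'a) set) r u v.
       I \<noteq> {} \<and> linear_order_on I r \<and>
       (\<forall>i\<in>I. u i \<prec> v i \<and> (u i, v i) \<approx> (x, y)) \<and>
       (\<forall>i\<in>I. \<forall>j\<in>I. (i, j) \<in> r \<and> i \<noteq> j \<longrightarrow> (u i, v i) \<nearrow> (u j, v j))
       \<longrightarrow> (\<Squnion>i\<in>I. u i) \<prec> (\<Squnion>i\<in>I. v i))"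

definition lower_regular :: "'a::{complete_lattice, modular_lattice} \<Rightarrow> 'a \<Rightarrow> bool" where
  "lower_regular x y \<longleftrightarrow> x \<prec> y \<and>
    (\<forall>(I :: ('a \<times> 'a) set) r u v.
       I \<noteq> {} \<and> linear_order_on I r \<and>
       (\<forall>i\<in>I. u i \<prec> v i \<and> (u i, v i) \<approx> (x, y)) \<and>
       (\<forall>i\<in>I. \<forall>j\<in>I. (i, j) \<in> r \<and> i \<noteq> j \<longrightarrow> (u j, v j) \<nearrow> (u i, v i))
       \<longrightarrow> (\<Sqinter>i\<in>I. u i) \<prec> (\<Sqinter>i\<in>I. v i))"

definition regular :: "'a::{complete_lattice, modular_lattice} \<Rightarrow> 'a \<Rightarrow> bool" where
  "regular x y \<longleftrightarrow> upper_regular x y \<and> lower_regular x y"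

lemma chain_of_pairs:
  fixes u v :: "'i \<Rightarrow> 'a::lattice"
  assumes lin: "linear_order_on I r"
    and up: "\<And>i j. i \<in> I \<Longrightarrow> j \<in> I \<Longrightarrow> (i, j) \<in> r \<Longrightarrow> i \<noteq> j \<Longrightarrow> (u i, v i) \<nearrow> (u j, v j)"
    and le: "\<And>i. i \<in> I \<Longrightarrow> u i \<le> v i"
  defines "P \<equiv> (\<lambda>i. (u i, v i)) ` I"
  shows "linear_order_on P {(p, q). p \<in> P \<and> q \<in> P \<and> p \<nearrow> q}"
proof -
  let ?s = "{(p, q). p \<in> P \<and> q \<in> P \<and> p \<nearrow> q}"
  have refl: "p \<nearrow> p" if "p \<in> P" for p
    using that le by (auto simp: P_def transposes_up_def inf_absorb2 sup_absorb1)
  have anti: "p = q" if "p \<nearrow> q" "q \<nearrow> p" for p q :: "'a \<times> 'a"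
  proof -
    obtain a b c d where eq: "p = (a, b)" "q = (c, d)" by (metis surj_pair)
    have "b \<sqinter> c = a" "b \<squnion> c = d" "d \<sqinter> a = c" "d \<squnion> a = b"
      using that by (auto simp: eq transposes_up_def)
    then have "a \<le> c" "c \<le> a" "b \<le> d" "d \<le> b"
      by (metis inf.cobounded2, metis inf.cobounded2, metis sup.cobounded1, metis sup.cobounded1)
    then show ?thesis by (simp add: eq)
  qed
  have total: "p \<nearrow> q \<or> q \<nearrow> p" if pq: "p \<in> P" "q \<in> P" for p q
  proof -
    obtain i j where ij: "i \<in> I" "j \<in> I" "p = (u i, v i)" "q = (u j, v j)"
      using pq by (auto simp: P_def)
    show ?thesis
    proof (cases "i = j")
      case True
      then show ?thesis using ij refl pq by auto
    next
      case False
      then have "(i, j) \<in> r \<or> (j, i) \<in> r"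
        using lin ij by (auto simp: linear_order_on_def total_on_def)
      then show ?thesis using up ij False by auto
    qed
  qed
  have trans: "p \<nearrow> t" if pq: "p \<nearrow> q" and qt: "q \<nearrow> t" for p q t :: "'a \<times> 'a"
  proof -
    obtain a b c d e f where eq: "p = (a, b)" "q = (c, d)" "t = (e, f)"
      by (metis surj_pair)
    have 1: "a \<le> b" "c \<le> d" "b \<sqinter> c = a" "b \<squnion> c = d" "e \<le> f" "d \<sqinter> e = c" "d \<squnion> e = f"
      using pq qt by (auto simp: eq transposes_up_def)
    have "b \<sqinter> e = b \<sqinter> (d \<sqinter> e)" using 1 by (metis inf_sup_absorb inf_assoc)
    moreover have "b \<squnion> e = b \<squnion> c \<squnion> e"
      using 1 by (metis sup_inf_absorb sup.commute sup.assoc inf.commute)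
    ultimately show ?thesis using 1 by (simp add: eq transposes_up_def)
  qed
  show ?thesis
    unfolding linear_order_on_def partial_order_on_def preorder_on_def
    using refl total by (auto simp: refl_on_def total_on_def antisym_def trans_def intro: trans dest: anti)
qed

lemma upper_regularD:
  fixes u v :: "'i \<Rightarrow> 'a::{complete_lattice, modular_lattice}"
  assumes reg: "upper_regular x y" and ne: "I \<noteq> {}" and lin: "linear_order_on I r"
    and cov: "\<And>i. i \<in> I \<Longrightarrow> u i \<prec> v i \<and> (u i, v i) \<approx> (x, y)"
    and up: "\<And>i j. i \<in> I \<Longrightarrow> j \<in> I \<Longrightarrow> (i, j) \<in> r \<Longrightarrow> i \<noteq> j \<Longrightarrow> (u i, v i) \<nearrow> (u j, v j)"
  shows "(\<Squnion>i\<in>I. u i) \<prec> (\<Squnion>i\<in>I. v i)"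
proof -
  let ?P = "(\<lambda>i. (u i, v i)) ` I"
  let ?s = "{(p, q). p \<in> ?P \<and> q \<in> ?P \<and> p \<nearrow> q}"
  have le: "u i \<le> v i" if "i \<in> I" for i
    using cov[OF that] by (auto simp: covering_def)
  have "linear_order_on ?P ?s"
    by (rule chain_of_pairs[OF lin up le])
  moreover have "?P \<noteq> {}" using ne by simp
  moreover have "\<forall>p\<in>?P. fst p \<prec> snd p \<and> (fst p, snd p) \<approx> (x, y)"
    using cov by auto
  moreover have "\<forall>p\<in>?P. \<forall>q\<in>?P. (p, q) \<in> ?s \<and> p \<noteq> q \<longrightarrow> (fst p, snd p) \<nearrow> (fst q, snd q)"
    by simp
  ultimately have "(\<Squnion>p\<in>?P. fst p) \<prec> (\<Squnion>p\<in>?P. snd p)"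
    using reg[unfolded upper_regular_def, THEN conjunct2, THEN spec[of _ ?P],
        THEN spec[of _ "?s"], THEN spec[of _ fst], THEN spec[of _ snd]]
    by fast
  then show ?thesis by (simp add: image_image)
qed

lemma lower_regularD:
  fixes u v :: "'i \<Rightarrow> 'a::{complete_lattice, modular_lattice}"
  assumes reg: "lower_regular x y" and ne: "I \<noteq> {}" and lin: "linear_order_on I r"
    and cov: "\<And>i. i \<in> I \<Longrightarrow> u i \<prec> v i \<and> (u i, v i) \<approx> (x, y)"
    and down: "\<And>i j. i \<in> I \<Longrightarrow> j \<in> I \<Longrightarrow> (i, j) \<in> r \<Longrightarrow> i \<noteq> j \<Longrightarrow> (u j, v j) \<nearrow> (u i, v i)"
  shows "(\<Sqinter>i\<in>I. u i) \<prec> (\<Sqinter>i\<in>I. v i)"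
proof -
  let ?P = "(\<lambda>i. (u i, v i)) ` I"
  let ?s = "{(p, q). p \<in> ?P \<and> q \<in> ?P \<and> p \<nearrow> q}"
  have lin': "linear_order_on I (r\<inverse>)" using lin by simp
  have le: "u i \<le> v i" if "i \<in> I" for i
    using cov[OF that] by (auto simp: covering_def)
  have "linear_order_on ?P ?s"
    by (rule chain_of_pairs[OF lin' _ le]) (simp_all add: down)
  then have "linear_order_on ?P (?s\<inverse>)" by simp
  moreover have "?P \<noteq> {}" using ne by simp
  moreover have "\<forall>p\<in>?P. fst p \<prec> snd p \<and> (fst p, snd p) \<approx> (x, y)"
    using cov by auto
  moreover have "\<forall>p\<in>?P. \<forall>q\<in>?P. (p, q) \<in> ?s\<inverse> \<and> p \<noteq> q \<longrightarrow> (fst q, snd q) \<nearrow> (fst p, snd p)"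
    by simp
  ultimately have "(\<Sqinter>p\<in>?P. fst p) \<prec> (\<Sqinter>p\<in>?P. snd p)"
    using reg[unfolded lower_regular_def, THEN conjunct2, THEN spec[of _ ?P],
        THEN spec[of _ "?s\<inverse>"], THEN spec[of _ fst], THEN spec[of _ snd]]
    by fast
  then show ?thesis by (simp add: image_image)
qed


section \<open>The lattice of filters\<close>

definition is_fil :: "'a::lattice set \<Rightarrow> bool" where
  "is_fil F \<longleftrightarrow> F \<noteq> {} \<and> (\<forall>a\<in>F. \<forall>b. a \<le> b \<longrightarrow> b \<in> F) \<and> (\<forall>a\<in>F. \<forall>b\<in>F. a \<sqinter> b \<in> F)"

typedef (overloaded) 'a fil = "{F :: 'a::lattice set. is_fil F}"
  morphisms set_of_fil Abs_fil
proof
  show "UNIV \<in> {F :: 'a set. is_fil F}" by (auto simp: is_fil_def)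
qed

setup_lifting type_definition_fil

lemma is_fil_nonempty: "is_fil F \<Longrightarrow> \<exists>a. a \<in> F"
  and is_fil_up: "is_fil F \<Longrightarrow> a \<in> F \<Longrightarrow> a \<le> b \<Longrightarrow> b \<in> F"
  and is_fil_inf: "is_fil F \<Longrightarrow> a \<in> F \<Longrightarrow> b \<in> F \<Longrightarrow> a \<sqinter> b \<in> F"
  by (auto simp: is_fil_def)

lemma is_fil_Inter:
  fixes \<F> :: "'a::bounded_lattice_top set set"
  assumes "\<And>F. F \<in> \<F> \<Longrightarrow> is_fil F"
  shows "is_fil (\<Inter>\<F>)"
proof -
  have top: "\<top> \<in> F" if "is_fil F" for F :: "'a set"
    using that by (auto simp: is_fil_def)
  then have "\<Inter>\<F> \<noteq> {}" using assms by blast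
  moreover have "b \<in> \<Inter>\<F>" if "a \<in> \<Inter>\<F>" "a \<le> b" for a b
  proof
    fix F assume "F \<in> \<F>"
    then show "b \<in> F" using that assms[of F] by (auto simp: is_fil_def)
  qed
  moreover have "a \<sqinter> b \<in> \<Inter>\<F>" if "a \<in> \<Inter>\<F>" "b \<in> \<Inter>\<F>" for a b
  proof
    fix F assume "F \<in> \<F>"
    then show "a \<sqinter> b \<in> F" using that assms[of F] by (auto simp: is_fil_def)
  qed
  ultimately show ?thesis unfolding is_fil_def by blast
qed

text \<open>The order is reverse inclusion, so suprema are intersections and the infimum of a family
  is the filter generated by its union.\<close>

instantiation fil :: (bounded_lattice_top) complete_lattice
begin

lift_definition less_eq_fil :: "'a fil \<Rightarrow> 'a fil \<Rightarrow> bool" is "\<lambda>F G. G \<subseteq> F" .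

definition less_fil :: "'a fil \<Rightarrow> 'a fil \<Rightarrow> bool" where
  "less_fil F G \<longleftrightarrow> F \<le> G \<and> \<not> G \<le> F"

lift_definition sup_fil :: "'a fil \<Rightarrow> 'a fil \<Rightarrow> 'a fil" is "(\<inter>)"
proof -
  fix F G :: "'a set" assume "is_fil F" "is_fil G"
  then have "is_fil (\<Inter>{F, G})" by (intro is_fil_Inter) auto
  then show "is_fil (F \<inter> G)" by simp
qed

lift_definition inf_fil :: "'a fil \<Rightarrow> 'a fil \<Rightarrow> 'a fil" is
  "\<lambda>F G. {z. \<exists>f\<in>F. \<exists>g\<in>G. f \<sqinter> g \<le> z}"
proof -
  fix F G :: "'a set" assume F: "is_fil F" and G: "is_fil G"
  show "is_fil {z. \<exists>f\<in>F. \<exists>g\<in>G. f \<sqinter> g \<le> z}"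
    unfolding is_fil_def
  proof (intro conjI ballI allI impI)
    obtain f g where "f \<in> F" "g \<in> G" using is_fil_nonempty[OF F] is_fil_nonempty[OF G] by blast
    then show "{z. \<exists>f\<in>F. \<exists>g\<in>G. f \<sqinter> g \<le> z} \<noteq> {}" by blast
  next
    fix a b assume "a \<in> {z. \<exists>f\<in>F. \<exists>g\<in>G. f \<sqinter> g \<le> z}" "a \<le> b"
    then show "b \<in> {z. \<exists>f\<in>F. \<exists>g\<in>G. f \<sqinter> g \<le> z}"
      using order_trans by blast
  next
    fix a b assume "a \<in> {z. \<exists>f\<in>F. \<exists>g\<in>G. f \<sqinter> g \<le> z}" "b \<in> {z. \<exists>f\<in>F. \<exists>g\<in>G. f \<sqinter> g \<le> z}"
    then obtain f g f' g' where *: "f \<in> F" "g \<in> G" "f \<sqinter> g \<le> a" "f' \<in> F" "g' \<in> G" "f' \<sqinter> g' \<le> b"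
      by blast
    have "(f \<sqinter> f') \<sqinter> (g \<sqinter> g') = (f \<sqinter> g) \<sqinter> (f' \<sqinter> g')"
      by (simp add: ac_simps)
    also have "\<dots> \<le> a \<sqinter> b" using * by (intro inf_mono)
    finally have "(f \<sqinter> f') \<sqinter> (g \<sqinter> g') \<le> a \<sqinter> b" .
    moreover have "f \<sqinter> f' \<in> F" "g \<sqinter> g' \<in> G"
      using * F G by (auto simp: is_fil_def)
    ultimately show "a \<sqinter> b \<in> {z. \<exists>f\<in>F. \<exists>g\<in>G. f \<sqinter> g \<le> z}" by blast
  qed
qed

lift_definition Sup_fil :: "'a fil set \<Rightarrow> 'a fil" is "\<lambda>\<F>. \<Inter>\<F>"
  using is_fil_Inter by blast

lift_definition Inf_fil :: "'a fil set \<Rightarrow> 'a fil" is "\<lambda>\<F>. \<Inter>{F. is_fil F \<and> \<Union>\<F> \<subseteq> F}"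
  by (rule is_fil_Inter) auto

lift_definition top_fil :: "'a fil" is "{\<top>}"
  by (auto simp: is_fil_def top_unique)

lift_definition bot_fil :: "'a fil" is UNIV
  by (auto simp: is_fil_def)

instance
proof
  fix F G H :: "'a fil" and A :: "'a fil set"
  show "(F < G) = (F \<le> G \<and> \<not> G \<le> F)" by (simp add: less_fil_def)
  show "F \<le> F" by transfer simp
  show "F \<le> H" if "F \<le> G" "G \<le> H" using that by transfer simp
  show "F = G" if "F \<le> G" "G \<le> F" using that by transfer simp
  show "F \<sqinter> G \<le> F"
  proof transfer
    fix F G :: "'a set" assume "is_fil F" "is_fil G"
    then obtain g where "g \<in> G" using is_fil_nonempty by blast
    then show "F \<subseteq> {z. \<exists>f\<in>F. \<exists>g\<in>G. f \<sqinter> g \<le> z}" using inf_le1 by blast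
  qed
  show "F \<sqinter> G \<le> G"
  proof transfer
    fix F G :: "'a set" assume "is_fil F" "is_fil G"
    then obtain f where "f \<in> F" using is_fil_nonempty by blast
    then show "G \<subseteq> {z. \<exists>f\<in>F. \<exists>g\<in>G. f \<sqinter> g \<le> z}" using inf_le2 by blast
  qed
  show "F \<le> G \<sqinter> H" if "F \<le> G" "F \<le> H"
    using that
  proof transfer
    fix F G H :: "'a set" assume *: "is_fil F" "G \<subseteq> F" "H \<subseteq> F"
    show "{z. \<exists>f\<in>G. \<exists>g\<in>H. f \<sqinter> g \<le> z} \<subseteq> F"
    proof clarify
      fix z f g assume "f \<in> G" "g \<in> H" "f \<sqinter> g \<le> z"
      with * show "z \<in> F" by (meson is_fil_inf is_fil_up subsetD)
    qed
  qed
  show "F \<le> F \<squnion> G" by transfer simp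
  show "G \<le> F \<squnion> G" by transfer simp
  show "G \<squnion> H \<le> F" if "G \<le> F" "H \<le> F" using that by transfer simp
  show "\<Sqinter>A \<le> F" if "F \<in> A"
    using that unfolding less_eq_fil.rep_eq Inf_fil.rep_eq by blast
  show "F \<le> \<Sqinter>A" if "\<And>G. G \<in> A \<Longrightarrow> F \<le> G"
  proof -
    have "is_fil (set_of_fil F)" using set_of_fil[of F] by simp
    then show ?thesis
      using that unfolding less_eq_fil.rep_eq Inf_fil.rep_eq by blast
  qed
  show "F \<le> \<Squnion>A" if "F \<in> A"
    using that unfolding less_eq_fil.rep_eq Sup_fil.rep_eq by blast
  show "\<Squnion>A \<le> F" if "\<And>G. G \<in> A \<Longrightarrow> G \<le> F"
    using that unfolding less_eq_fil.rep_eq Sup_fil.rep_eq by blast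
  show "\<Sqinter>{} = (\<top> :: 'a fil)"
  proof transfer
    have "is_fil {\<top> :: 'a}" by (auto simp: is_fil_def top_unique)
    moreover have "\<top> \<in> F" if "is_fil F" for F :: "'a set"
      using that by (auto simp: is_fil_def)
    ultimately show "\<Inter>{F :: 'a set. is_fil F \<and> \<Union>{} \<subseteq> F} = {\<top>}" by auto
  qed
  show "\<Squnion>{} = (\<bottom> :: 'a fil)" by transfer simp
qed

end

instance fil :: ("{bounded_lattice_top, modular_lattice}") modular_lattice
proof
  fix F G H :: "'a fil"
  assume FH: "F \<le> H"
  show "F \<squnion> (G \<sqinter> H) = (F \<squnion> G) \<sqinter> H"
  proof (rule antisym)
    show "F \<squnion> (G \<sqinter> H) \<le> (F \<squnion> G) \<sqinter> H"
      using FH by (meson inf.cobounded1 inf.cobounded2 le_infI le_supI le_supI2 sup.cobounded1)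
    show "(F \<squnion> G) \<sqinter> H \<le> F \<squnion> (G \<sqinter> H)"
      using FH
    proof transfer
      fix F G H :: "'a set"
      assume fil: "is_fil F" "is_fil G" "is_fil H" and HF: "H \<subseteq> F"
      show "F \<inter> {z. \<exists>f\<in>G. \<exists>g\<in>H. f \<sqinter> g \<le> z} \<subseteq> {z. \<exists>f\<in>F \<inter> G. \<exists>g\<in>H. f \<sqinter> g \<le> z}"
      proof
        fix z assume "z \<in> F \<inter> {z. \<exists>f\<in>G. \<exists>g\<in>H. f \<sqinter> g \<le> z}"
        then obtain g h where z: "z \<in> F" "g \<in> G" "h \<in> H" "g \<sqinter> h \<le> z" by blast
        define a where "a = (z \<sqinter> h) \<squnion> g"
        have "z \<sqinter> h \<in> F" using fil z HF by (auto simp: is_fil_def)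
        then have "a \<in> F \<inter> G" using fil z unfolding a_def is_fil_def
          by (meson IntI sup.cobounded1 sup.cobounded2)
        moreover have "a \<sqinter> h = (z \<sqinter> h) \<squnion> (g \<sqinter> h)"
          unfolding a_def by (simp add: modular_law)
        moreover have "(z \<sqinter> h) \<squnion> (g \<sqinter> h) \<le> z" using z by simp
        ultimately show "z \<in> {z. \<exists>f\<in>F \<inter> G. \<exists>g\<in>H. f \<sqinter> g \<le> z}"
          using z \<open>a \<in> F \<inter> G\<close> by (metis (mono_tags, lifting) mem_Collect_eq)
      qed
    qed
  qed
qed

lift_definition Fg :: "'a::lattice \<Rightarrow> 'a fil" is "\<lambda>x. {z. x \<le> z}"
proof -
  fix x :: 'a
  have "x \<in> {z. x \<le> z}" by simp
  moreover have "b \<in> {z. x \<le> z}" if "a \<in> {z. x \<le> z}" "a \<le> b" for a b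
    using that order_trans[of x a b] by simp
  ultimately show "is_fil {z. x \<le> z}" unfolding is_fil_def by auto
qed

end

theory Submission
  imports Defs
begin

text \<open>Every covering of filters projectively equivalent to \<open>Fg x \<prec> Fg y\<close> transposes up to a covering
  of principal filters coming from a covering of \<open>L\<close> projectively equivalent to \<open>x \<prec> y\<close>, and the
  latter may be chosen below any given member of the upper filter. Working from the top down, finitely many
  such coverings in a chain of filters thus yield equally many in a chain of \<open>L\<close>, so no chain of
  filters has more than \<open>\<upsilon>[x \<prec> y]\<close> of them.

  Lower regularity holds because joins of filters distribute over infima of chains. For upper
  regularity, let \<open>U\<^sub>i \<prec> V\<^sub>i\<close> be a chain of transposes and choose \<open>j\<close> such that the number of coverings
  which can be stacked below \<open>U\<^sub>j\<close> is maximal. Transpose \<open>U\<^sub>j \<prec> V\<^sub>j\<close> up to \<open>Fg u \<prec> Fg v\<close> and use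
  meet-continuity to enlarge \<open>u\<close> to an element \<open>k\<close> maximal with \<open>k \<sqinter> v = u\<close>. If some \<open>U\<^sub>l\<close> did not
  lie below \<open>Fg k\<close>, there would be a common upper transpose, contradicting maximality of \<open>k\<close>, or
  a further covering between \<open>U\<^sub>j\<close> and \<open>U\<^sub>l\<close>, contradicting the choice of \<open>j\<close>. So \<open>Fg k\<close> bounds all
  \<open>U\<^sub>l\<close>, and it does not lie above \<open>V\<^sub>j\<close>.

  By regularity, a covering \<open>a \<prec> b\<close> determines in a maximal chain the covering \<open>c \<prec> d\<close> at which
  \<open>a \<squnion> c\<close> changes to a bound of \<open>b\<close>. Coverings stacked in a chain determine distinct ones, so
  every maximal chain attains the bound.\<close>



section \<open>Transposes, coverings and projectivity in modular lattices\<close>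

section \<open>Transposition and projectivity\<close>

lemma transposes_up_iff:
  "(a, b) \<nearrow> (c, d) \<longleftrightarrow> a \<le> b \<and> c \<le> d \<and> b \<sqinter> c = a \<and> b \<squnion> c = d"
  by (simp add: transposes_up_def)

lemma transposes_upI:
  "b \<sqinter> c = a \<Longrightarrow> b \<squnion> c = d \<Longrightarrow> (a, b) \<nearrow> (c, d)"
  by (auto simp: transposes_up_iff)

lemma transposes_up_le:
  assumes "(a, b) \<nearrow> (c, d)"
  shows "a \<le> b" "c \<le> d" "a \<le> c" "b \<le> d"
  using assms by (auto simp: transposes_up_iff)

lemma transposes_up_trans:
  assumes "(a, b) \<nearrow> (c, d)" "(c, d) \<nearrow> (e, f)"
  shows "(a, b) \<nearrow> (e, f)"
proof (rule transposes_upI)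
  have *: "b \<sqinter> c = a" "b \<squnion> c = d" "d \<sqinter> e = c" "d \<squnion> e = f"
    using assms by (auto simp: transposes_up_iff)
  show "b \<sqinter> e = a" using * by (metis inf_sup_absorb inf_assoc)
  show "b \<squnion> e = f" using * by (metis sup_inf_absorb sup.commute sup.assoc inf.commute)
qed

text \<open>A transposition can be cut at any \<open>g\<close> between the two upper ends; the
  modular law for \<open>b \<le> g\<close> supplies the join. This later moves transposes of filters
  down to smaller elements.\<close>

lemma transposes_up_between:
  fixes a b c d g :: "'a::modular_lattice"
  assumes t: "(a, b) \<nearrow> (c, d)" and g: "b \<le> g" "g \<le> d"
  shows "(a, b) \<nearrow> (c \<sqinter> g, g)" "(c \<sqinter> g, g) \<nearrow> (c, d)"
proof -
  have *: "b \<sqinter> c = a" "b \<squnion> c = d" using t by (auto simp: transposes_up_iff)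
  show "(a, b) \<nearrow> (c \<sqinter> g, g)"
  proof (rule transposes_upI)
    show "b \<sqinter> (c \<sqinter> g) = a" using * g by (metis inf.absorb1 inf.assoc inf.commute)
    show "b \<squnion> (c \<sqinter> g) = g" using modular_law[OF g(1), of c] * g by (simp add: inf.absorb2)
  qed
  show "(c \<sqinter> g, g) \<nearrow> (c, d)"
  proof (rule transposes_upI)
    show "g \<squnion> c = d"
      using * g transposes_up_le[OF t] by (metis antisym sup_least sup_mono order_refl)
  qed (simp add: inf.commute)
qed

text \<open>The point is \<open>(a' \<squnion> b) \<sqinter> c = a' \<squnion> (b \<sqinter> c) = a'
  \<squnion> a = a'\<close>, by modularity.\<close>

lemma transposes_up_factor:
  fixes a b c d a' b' :: "'a::modular_lattice"
  assumes t: "(a, b) \<nearrow> (a', b')" and s: "(a, b) \<nearrow> (c, d)" and le: "a' \<le> c"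
  shows "(a', b') \<nearrow> (c, d)"
proof (rule transposes_upI)
  have *: "b \<sqinter> a' = a" "b \<squnion> a' = b'" "b \<sqinter> c = a" "b \<squnion> c = d" "a \<le> a'"
    using t s transposes_up_le(3)[OF t] by (auto simp: transposes_up_iff)
  show "b' \<sqinter> c = a'" using modular_law[OF le, of b] * by (metis sup.commute sup.absorb1)
  show "b' \<squnion> c = d" using * le by (metis sup.assoc sup.absorb2)
qed

lemma covering_iff:
  "a \<prec> b \<longleftrightarrow> a \<le> b \<and> a \<noteq> b \<and> (\<forall>z. a \<le> z \<longrightarrow> z \<le> b \<longrightarrow> z = a \<or> z = b)"
  unfolding covering_def less_le by blast

lemma covering_cases: "a \<prec> b \<Longrightarrow> a \<le> z \<Longrightarrow> z \<le> b \<Longrightarrow> z = a \<or> z = b"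
  by (simp add: covering_iff)

lemma covering_le: "a \<prec> b \<Longrightarrow> a \<le> b"
  by (simp add: covering_iff)

text \<open>Dedekind's transposition principle: meeting with \<open>b\<close> and joining with
  \<open>c\<close> are inverse maps between the two intervals (facts \<open>up\<close> and
  \<open>down\<close>), so interior points correspond.\<close>

lemma covering_transposes_up:
  fixes a b c d :: "'a::modular_lattice"
  assumes t: "(a, b) \<nearrow> (c, d)"
  shows "a \<prec> b \<longleftrightarrow> c \<prec> d"
proof -
  have *: "b \<sqinter> c = a" "b \<squnion> c = d" "a \<le> b" "c \<le> d" "a \<le> c" "b \<le> d"
    using t transposes_up_le[OF t] by (auto simp: transposes_up_iff)
  have up: "b \<sqinter> (z \<squnion> c) = z" if "a \<le> z" "z \<le> b" for z
    using modular_law[OF that(2), of c] that * by (simp add: inf.commute sup.absorb1)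
  have down: "(b \<sqinter> z) \<squnion> c = z" if "c \<le> z" "z \<le> d" for z
    using modular_law[OF that(1), of b] that * by (simp add: sup.commute inf.absorb2)
  show ?thesis
  proof
    assume cov: "a \<prec> b"
    have "c \<noteq> d" using cov * by (auto simp: covering_iff inf.absorb1)
    moreover have "z = c \<or> z = d" if z: "c \<le> z" "z \<le> d" for z
    proof -
      have "a \<le> b \<sqinter> z" "b \<sqinter> z \<le> b" using * z by (auto intro: order_trans)
      then have "b \<sqinter> z = a \<or> b \<sqinter> z = b"
        by (rule covering_cases[OF cov])
      then show ?thesis using down[OF z] *(2) sup.absorb2[OF *(5)] by metis
    qed
    ultimately show "c \<prec> d" using * by (simp add: covering_iff)
  next
    assume cov: "c \<prec> d"
    have "a \<noteq> b" using cov * by (auto simp: covering_iff sup.absorb2)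
    moreover have "z = a \<or> z = b" if z: "a \<le> z" "z \<le> b" for z
    proof -
      have "c \<le> z \<squnion> c" "z \<squnion> c \<le> d" using * z by (auto intro: order_trans)
      then have "z \<squnion> c = c \<or> z \<squnion> c = d"
        by (rule covering_cases[OF cov])
      then show ?thesis using up[OF z] *(1) inf.absorb1[OF *(6)] by metis
    qed
    ultimately show "a \<prec> b" using * by (simp add: covering_iff)
  qed
qed

lemma covering_inf_eq:
  fixes a b c :: "'a::lattice"
  assumes "a \<prec> b" "a \<le> c" "\<not> b \<le> c"
  shows "b \<sqinter> c = a"
  using covering_cases[OF assms(1), of "b \<sqinter> c"] covering_le[OF assms(1)] assms(2,3)
  by (metis inf.cobounded1 inf.cobounded2 le_inf_iff)

lemma projective_induct:
  assumes "p \<approx> q" "P p"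
    and "\<And>a b. P a \<Longrightarrow> a \<nearrow> b \<Longrightarrow> P b" "\<And>a b. P b \<Longrightarrow> a \<nearrow> b \<Longrightarrow> P a"
  shows "P q"
  using assms(1) unfolding projective_def
proof (induction rule: tranclp_induct)
  case (base q)
  then show ?case using assms(2-4) unfolding symclp_def by blast
next
  case (step q r)
  then show ?case using assms(3,4) unfolding symclp_def by blast
qed

lemma transposes_up_projective: "p \<nearrow> q \<Longrightarrow> p \<approx> q"
  by (auto simp: projective_def symclp_def)

lemma projective_sym: "p \<approx> q \<Longrightarrow> q \<approx> p"
  unfolding projective_def
proof (induction rule: tranclp_induct)
  case (base q)
  then show ?case by (simp add: symclp_def disj_commute tranclp.r_into_trancl)
next
  case (step q r)
  then have "symclp (\<nearrow>) r q" by (simp add: symclp_def disj_commute)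
  then show ?case using step.IH by (rule tranclp_into_tranclp2)
qed

lemma projective_trans: "p \<approx> q \<Longrightarrow> q \<approx> r \<Longrightarrow> p \<approx> r"
  unfolding projective_def by (rule tranclp_trans)

text \<open>The closure is not reflexive by construction, but an interval transposes up to
  itself.\<close>

lemma projective_refl: "a \<le> b \<Longrightarrow> (a, b) \<approx> (a, b)"
  by (rule transposes_up_projective, rule transposes_upI) (auto simp: inf.absorb2 sup.absorb1)

lemma covering_projective:
  fixes p q :: "'a::modular_lattice \<times> 'a"
  assumes "p \<approx> q" "fst p \<prec> snd p"
  shows "fst q \<prec> snd q"
  using assms
proof (rule projective_induct)
  fix a b :: "'a \<times> 'a"
  assume "a \<nearrow> b"
  then have "fst a \<prec> snd a \<longleftrightarrow> fst b \<prec> snd b"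
    by (intro covering_transposes_up) simp
  then show "fst a \<prec> snd a \<Longrightarrow> fst b \<prec> snd b" "fst b \<prec> snd b \<Longrightarrow> fst a \<prec> snd a"
    by simp_all
qed

text \<open>If the two upper transposes of \<open>(a, b)\<close> have no common upper transpose, then \<open>c, c', b\<close>
  together span a diamond, one side of which is found below \<open>c'\<close>.\<close>

lemma extra_covering:
  fixes a b c d c' d' :: "'a::modular_lattice"
  assumes cov: "a \<prec> b" and t: "(a, b) \<nearrow> (c, d)" and s: "(a, b) \<nearrow> (c', d')" and le: "b \<le> c \<squnion> c'"
  obtains e f where "a \<le> e" "e \<prec> f" "f \<le> c'" "(e, f) \<approx> (a, b)"
proof
  have *: "b \<squnion> c = d" "a \<le> c" "c \<le> d" "a \<le> c'"
    using t s transposes_up_le[OF t] transposes_up_le[OF s] by (auto simp: transposes_up_iff)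
  have u: "(c \<sqinter> c', d \<sqinter> c') \<nearrow> (c, d)"
  proof (rule transposes_upI)
    show "d \<sqinter> c' \<sqinter> c = c \<sqinter> c'" using *
      by (metis inf.absorb2 inf.assoc inf.commute)
    have "d \<le> c \<squnion> c'" using * le by auto
    then show "d \<sqinter> c' \<squnion> c = d"
      using modular_law[OF *(3), of c'] by (simp add: ac_simps inf.absorb1)
  qed
  show "a \<le> c \<sqinter> c'" using * by simp
  show "c \<sqinter> c' \<prec> d \<sqinter> c'" using cov covering_transposes_up[OF t] covering_transposes_up[OF u] by simp
  show "(c \<sqinter> c', d \<sqinter> c') \<approx> (a, b)"
    using transposes_up_projective[OF u] transposes_up_projective[OF t]
    by (blast intro: projective_trans projective_sym)
qed simp


section \<open>Principal filters and descent of projectivities from filters to elements\<close>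

section \<open>Principal filters\<close>

lemma is_fil_set_of_fil: "is_fil (set_of_fil F)"
  using set_of_fil[of F] by simp

text \<open>Under reverse inclusion the members of a filter are exactly its principal upper
  bounds.\<close>

lemma le_Fg_iff: "F \<le> Fg a \<longleftrightarrow> a \<in> set_of_fil F"
  by transfer (auto dest: is_fil_up)

lemma Fg_le_iff: "Fg a \<le> Fg b \<longleftrightarrow> a \<le> b"
  by (simp add: le_Fg_iff Fg.rep_eq)

lemma Fg_inf: "Fg (a \<sqinter> b) = Fg a \<sqinter> Fg (b :: 'a::bounded_lattice_top)"
  by transfer (auto intro: order_trans inf_mono)

lemma Fg_sup: "Fg (a \<squnion> b) = Fg a \<squnion> Fg (b :: 'a::bounded_lattice_top)"
  by transfer auto

lemma Fg_inj: "Fg a = Fg b \<longleftrightarrow> a = (b :: 'a::bounded_lattice_top)"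
  by (metis Fg_le_iff antisym order_refl)

lemma Fg_transposes_up_iff:
  fixes a b c d :: "'a::bounded_lattice_top"
  shows "(Fg a, Fg b) \<nearrow> (Fg c, Fg d) \<longleftrightarrow> (a, b) \<nearrow> (c, d)"
  by (simp add: transposes_up_iff Fg_le_iff Fg_inj flip: Fg_inf Fg_sup)

lemma Fg_projective:
  fixes p q :: "'a::bounded_lattice_top \<times> 'a"
  assumes "p \<approx> q"
  shows "map_prod Fg Fg p \<approx> map_prod Fg Fg q"
proof -
  have step: "symclp (\<nearrow>) (map_prod Fg Fg a) (map_prod Fg Fg b)" if "symclp (\<nearrow>) a b"
    for a b :: "'a \<times> 'a"
    using that by (cases a; cases b) (auto simp: symclp_def Fg_transposes_up_iff)
  show ?thesis
    using assms unfolding projective_def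
    by (induction rule: tranclp_induct) (blast intro: step tranclp.intros)+
qed

text \<open>A filter \<open>H\<close> strictly between would have a member \<open>h\<close> not
  above \<open>y\<close>; since \<open>y\<close> is a member too, so is
  \<open>y \<sqinter> h = x\<close>, whence \<open>H \<le> Fg x\<close>.\<close>

lemma Fg_covering:
  fixes x y :: "'a::bounded_lattice_top"
  assumes "x \<prec> y"
  shows "Fg x \<prec> Fg y"
  unfolding covering_def
proof
  show "Fg x < Fg y" using assms by (auto simp: less_le_not_le Fg_le_iff covering_def)
  show "\<not> (\<exists>H. Fg x < H \<and> H < Fg y)"
  proof
    assume "\<exists>H. Fg x < H \<and> H < Fg y"
    then obtain H where H: "Fg x \<le> H" "\<not> H \<le> Fg x" "H \<le> Fg y" "\<not> Fg y \<le> H"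
      by (auto simp: less_le_not_le)
    from H(4) obtain h where h: "h \<in> set_of_fil H" "\<not> y \<le> h"
      by (auto simp: less_eq_fil.rep_eq Fg.rep_eq)
    have "x \<le> h" using H(1) h(1) by (auto simp: less_eq_fil.rep_eq Fg.rep_eq)
    then have "y \<sqinter> h = x" using covering_inf_eq assms h(2) by blast
    then have "x \<in> set_of_fil H"
      using H(3) h(1) is_fil_inf[OF is_fil_set_of_fil] by (metis le_Fg_iff)
    then show False using H(2) by (simp add: le_Fg_iff)
  qed
qed

text \<open>Induction along the projectivity, starting at \<open>(Fg x, Fg y)\<close>. Going down a
  transposition is transitivity; going up requires replacing \<open>(u, v)\<close> by a pair above
  the new filters.\<close>

lemma projective_Fg_transposes_up:
  fixes x y :: "'a::{bounded_lattice_top, modular_lattice}"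
  assumes "x \<le> y" and "(F, G) \<approx> (Fg x, Fg y)"
  obtains u v where "(F, G) \<nearrow> (Fg u, Fg v)" "(u, v) \<approx> (x, y)"
proof -
  define P where "P p \<longleftrightarrow> (\<exists>u v. p \<nearrow> (Fg u, Fg v) \<and> (u, v) \<approx> (x, y))" for p :: "'a fil \<times> 'a fil"
  have "P (F, G)"
  proof (rule projective_induct[OF projective_sym[OF assms(2)]])
    have "(Fg x, Fg y) \<nearrow> (Fg x, Fg y)"
      using assms(1) by (intro transposes_upI) (auto simp: inf.absorb2 sup.absorb1 Fg_le_iff)
    then show "P (Fg x, Fg y)" unfolding P_def using projective_refl[OF assms(1)] by blast
  next
    fix p q assume "P q" "p \<nearrow> q"
    then show "P p" unfolding P_def using transposes_up_trans by (metis prod.collapse)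
  next
    fix p q assume "P p" and pq: "p \<nearrow> q"
    then obtain u v where uv: "p \<nearrow> (Fg u, Fg v)" "(u, v) \<approx> (x, y)" unfolding P_def by blast
    obtain F G F' G' where eq: "p = (F, G)" "q = (F', G')" by (metis surj_pair)
    have t: "(F, G) \<nearrow> (Fg u, Fg v)" and s: "(F, G) \<nearrow> (F', G')" using uv pq eq by auto
    \<comment> \<open>The meet is \<open>F\<close>. Its being below a principal filter is witnessed
      by one member of \<open>G\<close> and one of \<open>F'\<close>.\<close>
    have "G \<sqinter> F' \<le> Fg u" using t s transposes_up_le[OF t] by (simp add: transposes_up_iff)
    then obtain g0 f where gf: "g0 \<in> set_of_fil G" "f \<in> set_of_fil F'" "g0 \<sqinter> f \<le> u"
      by (auto simp: le_Fg_iff inf_fil.rep_eq)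
    define g where "g = g0 \<sqinter> v"
    define u' where "u' = u \<sqinter> g"
    \<comment> \<open>Joining \<open>u'\<close> to \<open>f\<close> stays in \<open>F'\<close> and,
      by modularity, makes the meet with \<open>g\<close> exactly \<open>u'\<close>.\<close>
    define f' where "f' = f \<squnion> u'"
    have "G \<le> Fg g" using gf(1) transposes_up_le[OF t] by (simp add: g_def Fg_inf le_Fg_iff)
    moreover have "Fg g \<le> Fg v" by (simp add: Fg_le_iff g_def)
    ultimately have *: "(F, G) \<nearrow> (Fg u', Fg g)" "(Fg u', Fg g) \<nearrow> (Fg u, Fg v)"
      using transposes_up_between[OF t] by (simp_all add: u'_def Fg_inf)
    have "g \<sqinter> f \<le> g0 \<sqinter> f" unfolding g_def by (intro inf_mono) auto
    then have "g \<sqinter> f \<le> u" using gf(3) by (rule order_trans)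
    then have "g \<sqinter> f \<le> u'" by (simp add: u'_def)
    then have "g \<sqinter> f' = u'"
      using modular_law[of u' g f] unfolding f'_def
      by (simp add: u'_def inf.commute sup.commute sup.absorb2)
    then have "(u', g) \<nearrow> (f', g \<squnion> f')" by (intro transposes_upI) auto
    then have **: "(Fg u', Fg g) \<nearrow> (Fg f', Fg (g \<squnion> f'))" and pr: "(u', g) \<approx> (f', g \<squnion> f')"
      by (simp_all add: Fg_transposes_up_iff transposes_up_projective)
    have "F' \<le> Fg f'" using is_fil_up[OF is_fil_set_of_fil gf(2)] by (simp add: le_Fg_iff f'_def)
    \<comment> \<open>Both pairs are upper transposes of \<open>(F, G)\<close> with comparable lower
      ends.\<close>
    then have "q \<nearrow> (Fg f', Fg (g \<squnion> f'))"
      using transposes_up_factor[OF s transposes_up_trans[OF *(1) **]] eq by simp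
    moreover have "(u', g) \<approx> (u, v)" using *(2) by (simp add: Fg_transposes_up_iff transposes_up_projective)
    ultimately show "P q" unfolding P_def using pr uv(2) by (meson projective_sym projective_trans)
  qed
  then show thesis using that unfolding P_def by blast
qed


section \<open>Stacks: families of coverings carried by a chain\<close>

section \<open>Stacks of coverings\<close>

text \<open>A chain-free form of the sets counted by \<open>chain_mult\<close>: up to passing to
  subsets, these are the sets \<open>coverings_in C x y\<close> for chains \<open>C\<close>.
  Coverings can thus be added without tracking a chain.\<close>

definition stack :: "'a::lattice \<Rightarrow> 'a \<Rightarrow> ('a \<times> 'a) set \<Rightarrow> bool" where
  "stack x y T \<longleftrightarrow> (\<forall>p\<in>T. fst p \<prec> snd p \<and> p \<approx> (x, y)) \<and>
     (\<forall>p\<in>T. \<forall>q\<in>T. p \<noteq> q \<longrightarrow> snd p \<le> fst q \<or> snd q \<le> fst p)"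

lemma stack_subset: "stack x y T \<Longrightarrow> S \<subseteq> T \<Longrightarrow> stack x y S"
  by (meson stack_def subsetD)

text \<open>If two coverings of a chain overlapped, their ends would be forced to coincide.\<close>

lemma stack_coverings_in:
  assumes "is_chain C"
  shows "stack x y (coverings_in C x y)"
proof -
  have lin: "u \<le> v \<or> v \<le> u" if "u \<in> C" "v \<in> C" for u v
    using assms that by (auto simp: pred_on.chain_def)
  have "b \<le> c \<or> d \<le> a" if ab: "a \<in> C" "b \<in> C" "a \<prec> b" and cd: "c \<in> C" "d \<in> C" "c \<prec> d"
    and ne: "(a, b) \<noteq> (c, d)" for a b c d
  proof (rule ccontr)
    assume "\<not> (b \<le> c \<or> d \<le> a)"
    then have lt: "c < b" "a < d" using lin ab cd by (metis less_le)+
    have "a = c" using lin[of a c] lt ab cd by (auto simp: covering_def less_le)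
    moreover have "b = d" using lin[of b d] lt ab cd by (auto simp: covering_def less_le)
    ultimately show False using ne by simp
  qed
  then show ?thesis unfolding stack_def coverings_in_def by fastforce
qed

lemma stack_in_chain:
  assumes "stack x y T"
  obtains C where "is_chain C" "T \<subseteq> coverings_in C x y"
proof
  have T: "p \<in> T \<Longrightarrow> q \<in> T \<Longrightarrow> p = q \<or> snd p \<le> fst q \<or> snd q \<le> fst p"
    "p \<in> T \<Longrightarrow> fst p \<le> snd p" for p q
    using assms by (auto simp: stack_def covering_def)
  have *: "fst p \<le> fst q \<or> fst q \<le> fst p" "snd p \<le> fst q \<or> fst q \<le> snd p"
    "snd p \<le> snd q \<or> snd q \<le> snd p" if "p \<in> T" "q \<in> T" for p q
    using T(1)[OF that] T(2)[OF that(1)] T(2)[OF that(2)]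
    by (auto intro: order_trans)
  show "is_chain (fst ` T \<union> snd ` T)"
    unfolding pred_on.chain_def using * by fast
  show "T \<subseteq> coverings_in (fst ` T \<union> snd ` T) x y"
  proof
    fix p assume "p \<in> T"
    then show "p \<in> coverings_in (fst ` T \<union> snd ` T) x y"
      using assms by (auto simp: stack_def coverings_in_def image_iff split_beta)
  qed
qed

lemma stack_insert:
  assumes "stack x y T" "u \<prec> v" "(u, v) \<approx> (x, y)"
    and "\<And>p. p \<in> T \<Longrightarrow> v \<le> fst p \<or> snd p \<le> u"
  shows "stack x y (insert (u, v) T)" "(u, v) \<notin> T"
proof -
  show "stack x y (insert (u, v) T)" using assms unfolding stack_def by auto
  show "(u, v) \<notin> T" using assms(2) assms(4)[of "(u, v)"] by (auto simp: covering_def)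
qed

lemma stack_Fg:
  fixes x y :: "'a::bounded_lattice_top"
  assumes "stack x y T"
  shows "stack (Fg x) (Fg y) (map_prod Fg Fg ` T)"
  unfolding stack_def
proof (intro conjI ballI impI)
  fix p assume "p \<in> map_prod Fg Fg ` T"
  then obtain t where t: "p = map_prod Fg Fg t" "t \<in> T" by (rule imageE)
  have "fst t \<prec> snd t" "t \<approx> (x, y)" using t(2) assms by (auto simp: stack_def)
  then show "fst p \<prec> snd p" "p \<approx> (Fg x, Fg y)"
    using t(1) Fg_covering Fg_projective[of t "(x, y)"] by (simp_all add: split_beta)
next
  fix p q assume "p \<in> map_prod Fg Fg ` T" "q \<in> map_prod Fg Fg ` T" "p \<noteq> q"
  then show "snd p \<le> fst q \<or> snd q \<le> fst p"
    using assms unfolding stack_def by (fastforce simp: Fg_le_iff)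
qed

lemma fil_lower_bound:
  assumes "is_fil F" "finite A" "A \<subseteq> F"
  obtains w where "w \<in> F" "\<forall>a\<in>A. w \<le> a"
proof -
  have "\<exists>w\<in>F. \<forall>a\<in>A. w \<le> a" using assms(2,3)
  proof (induction rule: finite_induct)
    case empty then show ?case using is_fil_nonempty[OF assms(1)] by blast
  next
    case (insert a A)
    then obtain w where w: "w \<in> F" "\<forall>a\<in>A. w \<le> a" by auto
    then have "w \<sqinter> a \<in> F" using insert assms(1) is_fil_inf by auto
    then show ?case using w by (intro bexI[of _ "w \<sqinter> a"]) (auto intro: le_infI1)
  qed
  then show thesis using that by blast
qed

text \<open>Induction on the size, splitting off the lowest covering \<open>p\<close>. The last
  conjunct strengthens the induction: it keeps the coverings found for the rest above
  \<open>snd p\<close>, leaving room for one more underneath.\<close>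

lemma stack_of_filters:
  fixes x y :: "'a::{bounded_lattice_top, modular_lattice}"
  assumes xy: "x \<prec> y" and "finite T" "stack (Fg x) (Fg y) T"
  shows "\<exists>S. finite S \<and> stack x y S \<and> card S = card T \<and> (\<forall>q\<in>S. \<exists>p\<in>T. fst p \<le> Fg (fst q))"
  using assms(2,3)
proof (induction "card T" arbitrary: T)
  case 0
  then show ?case by (intro exI[of _ "{}"]) (auto simp: stack_def)
next
  case (Suc n)
  have "finite (fst ` T)" "fst ` T \<noteq> {}" using Suc by auto
  then obtain p where p: "p \<in> T" and min: "\<And>q. q \<in> T \<Longrightarrow> fst q \<le> fst p \<Longrightarrow> fst q = fst p"
    using finite_has_minimal[of "fst ` T"] by (smt (verit) imageE image_eqI)
  have covp: "fst p \<prec> snd p" "p \<approx> (Fg x, Fg y)" using p Suc by (auto simp: stack_def)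
  have above: "snd p \<le> fst q" if "q \<in> T" "q \<noteq> p" for q
  proof (rule ccontr)
    assume "\<not> snd p \<le> fst q"
    then have "snd q \<le> fst p" using that p Suc(4) unfolding stack_def by metis
    moreover have "fst q < snd q" using that Suc(4) by (auto simp: stack_def covering_def)
    ultimately show False using min[OF that(1)] by (metis leD less_le_trans order_less_imp_le)
  qed
  have "n = card (T - {p})" using Suc p by simp
  from Suc(1)[OF this] Suc(3,4)
  obtain S where S: "finite S" "stack x y S" "card S = n"
    "\<And>q. q \<in> S \<Longrightarrow> \<exists>p'\<in>T - {p}. fst p' \<le> Fg (fst q)"
    using \<open>n = card (T - {p})\<close> by (metis Diff_subset finite_Diff stack_subset)
  \<comment> \<open>All lower ends in \<open>S\<close> are members of the filter
    \<open>snd p\<close>, so finitely many of them have a common lower bound \<open>w\<close>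
    there.\<close>
  have "fst ` S \<subseteq> set_of_fil (snd p)"
    using S(4) above unfolding le_Fg_iff[symmetric] image_subset_iff
    by (metis DiffD1 DiffD2 order_trans singletonI)
  then obtain w where w: "w \<in> set_of_fil (snd p)" "\<And>q. q \<in> S \<Longrightarrow> w \<le> fst q"
    using fil_lower_bound[OF is_fil_set_of_fil finite_imageI[OF S(1), of fst]] by (metis image_eqI)
  obtain u v where uv: "p \<nearrow> (Fg u, Fg v)" "(u, v) \<approx> (x, y)"
    using projective_Fg_transposes_up[OF covering_le[OF xy], of "fst p" "snd p"] covp by auto
  have t: "(fst p, snd p) \<nearrow> (Fg u, Fg v)" using uv by simp
  \<comment> \<open>Cutting the transposition at \<open>g\<close> places the new covering below
    \<open>w\<close>, hence below all of \<open>S\<close>.\<close>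
  define g where "g = v \<sqinter> w"
  have "snd p \<le> Fg g" using w(1) transposes_up_le[OF t] by (simp add: g_def Fg_inf le_Fg_iff)
  moreover have "Fg g \<le> Fg v" by (simp add: Fg_le_iff g_def)
  ultimately have *: "(fst p, snd p) \<nearrow> (Fg (u \<sqinter> g), Fg g)" "(Fg (u \<sqinter> g), Fg g) \<nearrow> (Fg u, Fg v)"
    using transposes_up_between[OF t] by (simp_all add: Fg_inf)
  have pr: "(u \<sqinter> g, g) \<approx> (x, y)"
    using *(2) uv(2) by (simp add: Fg_transposes_up_iff) (meson transposes_up_projective projective_trans)
  have cov: "u \<sqinter> g \<prec> g" using covering_projective[OF projective_sym[OF pr]] xy by simp
  have ge: "g \<le> fst q" if "q \<in> S" for q using w(2)[OF that] by (simp add: g_def le_infI2)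
  note ins = stack_insert[OF S(2) cov pr, OF disjI1, OF ge]
  have "card (insert (u \<sqinter> g, g) S) = card T" using ins(2) S Suc(2) by simp
  moreover have "fst p \<le> Fg (u \<sqinter> g)" using transposes_up_le[OF *(1)] by simp
  ultimately show ?case
    using ins S p by (intro exI[of _ "insert (u \<sqinter> g, g) S"]) auto
qed


section \<open>Lower regularity from chains of filters, upper regularity from
  meet-continuity\<close>

section \<open>Regularity\<close>

text \<open>For a chain the union is already closed under meets, so nothing new is
  generated.\<close>

lemma Inf_fil_chain:
  fixes \<F> :: "'a::bounded_lattice_top fil set"
  assumes "\<F> \<noteq> {}" and lin: "\<And>F G. F \<in> \<F> \<Longrightarrow> G \<in> \<F> \<Longrightarrow> F \<le> G \<or> G \<le> F"
  shows "set_of_fil (\<Sqinter>\<F>) = (\<Union>F\<in>\<F>. set_of_fil F)"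
proof
  show "(\<Union>F\<in>\<F>. set_of_fil F) \<subseteq> set_of_fil (\<Sqinter>\<F>)"
    using Inf_lower[of _ \<F>] by (auto simp: less_eq_fil.rep_eq)
  have "is_fil (\<Union>F\<in>\<F>. set_of_fil F)"
    unfolding is_fil_def
  proof (intro conjI ballI allI impI)
    show "(\<Union>F\<in>\<F>. set_of_fil F) \<noteq> {}"
      using assms(1) is_fil_nonempty[OF is_fil_set_of_fil] by blast
    show "b \<in> (\<Union>F\<in>\<F>. set_of_fil F)" if "a \<in> (\<Union>F\<in>\<F>. set_of_fil F)" "a \<le> b" for a b
      using that is_fil_up[OF is_fil_set_of_fil] by blast
    show "a \<sqinter> b \<in> (\<Union>F\<in>\<F>. set_of_fil F)"
      if a: "a \<in> (\<Union>F\<in>\<F>. set_of_fil F)" and b: "b \<in> (\<Union>F\<in>\<F>. set_of_fil F)" for a b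
    proof -
      obtain F G where FG: "F \<in> \<F>" "G \<in> \<F>" "a \<in> set_of_fil F" "b \<in> set_of_fil G"
        using a b by blast
      then show ?thesis
        using lin[OF FG(1,2)] is_fil_inf[OF is_fil_set_of_fil] unfolding less_eq_fil.rep_eq by blast
    qed
  qed
  then show "set_of_fil (\<Sqinter>\<F>) \<subseteq> (\<Union>F\<in>\<F>. set_of_fil F)"
    unfolding Inf_fil.rep_eq by blast
qed

text \<open>The pair of infima transposes up to \<open>(U i, V i)\<close> for any fixed
  \<open>i\<close>, so it inherits the covering property.\<close>

lemma lower_regular_fil:
  fixes F G :: "'a::{bounded_lattice_top, modular_lattice} fil"
  assumes "F \<prec> G"
  shows "lower_regular F G"
  unfolding lower_regular_def
proof (intro conjI allI impI, fact assms, elim conjE)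
  fix I :: "('a fil \<times> 'a fil) set" and r and U V :: "'a fil \<times> 'a fil \<Rightarrow> 'a fil"
  assume ne: "I \<noteq> {}" and lin: "linear_order_on I r"
    and cov: "\<forall>i\<in>I. U i \<prec> V i \<and> (U i, V i) \<approx> (F, G)"
    and down: "\<forall>i\<in>I. \<forall>j\<in>I. (i, j) \<in> r \<and> i \<noteq> j \<longrightarrow> (U j, V j) \<nearrow> (U i, V i)"
  obtain i where i: "i \<in> I" using ne by blast
  have tot: "j = k \<or> (U j, V j) \<nearrow> (U k, V k) \<or> (U k, V k) \<nearrow> (U j, V j)" if "j \<in> I" "k \<in> I" for j k
    using lin down that by (metis linear_order_on_def total_on_def)
  have UV: "U j \<le> V j" if "j \<in> I" for j using cov that covering_le by blast
  have "(\<Sqinter>(U ` I), \<Sqinter>(V ` I)) \<nearrow> (U i, V i)"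
  proof (rule transposes_upI)
    have "\<Sqinter>(V ` I) \<sqinter> U i \<le> U j" if j: "j \<in> I" for j
      using tot[OF i j]
    proof (elim disjE)
      assume "(U j, V j) \<nearrow> (U i, V i)"
      then have "U j = V j \<sqinter> U i" by (simp add: transposes_up_iff)
      moreover have "\<Sqinter>(V ` I) \<sqinter> U i \<le> V j \<sqinter> U i" using j by (intro inf_mono INF_lower) auto
      ultimately show ?thesis by simp
    next
      assume "(U i, V i) \<nearrow> (U j, V j)"
      then show ?thesis by (auto dest: transposes_up_le intro: le_infI2)
    qed (simp add: le_infI2)
    moreover have "\<Sqinter>(U ` I) \<le> \<Sqinter>(V ` I)" using UV by (intro INF_mono) auto
    ultimately show "\<Sqinter>(V ` I) \<sqinter> U i = \<Sqinter>(U ` I)"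
      using i by (intro antisym INF_greatest) (auto intro: INF_lower)
  next
    have V_lin: "V j \<le> V k \<or> V k \<le> V j" if "j \<in> I" "k \<in> I" for j k
      using tot[OF that] by (auto dest: transposes_up_le(4))
    have V_Inf: "set_of_fil (\<Sqinter>(V ` I)) = (\<Union>F\<in>V ` I. set_of_fil F)"
    proof (rule Inf_fil_chain)
      show "A \<le> B \<or> B \<le> A" if A: "A \<in> V ` I" and B: "B \<in> V ` I" for A B
      proof -
        obtain j where "j \<in> I" "A = V j" using A by (rule imageE)
        moreover obtain k where "k \<in> I" "B = V k" using B by (rule imageE)
        ultimately show ?thesis using V_lin by simp
      qed
    qed (use ne in simp)
    show "\<Sqinter>(V ` I) \<squnion> U i = V i"
    proof (rule antisym)
      show "\<Sqinter>(V ` I) \<squnion> U i \<le> V i" using i UV by (auto intro: INF_lower)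
      show "V i \<le> \<Sqinter>(V ` I) \<squnion> U i"
        unfolding less_eq_fil.rep_eq sup_fil.rep_eq
      proof
        \<comment> \<open>A member of the infimum lies in a single \<open>V j\<close>, which reduces
          the claim to \<open>V i \<le> V j \<squnion> U i\<close>.\<close>
        fix z assume "z \<in> set_of_fil (\<Sqinter>(V ` I)) \<inter> set_of_fil (U i)"
        then obtain j where j: "j \<in> I" "z \<in> set_of_fil (V j)" "z \<in> set_of_fil (U i)"
          unfolding V_Inf by auto
        then have "z \<in> set_of_fil (V j \<squnion> U i)" by (simp add: sup_fil.rep_eq)
        moreover have "V i \<le> V j \<squnion> U i"
          using tot[OF i j(1)] transposes_up_le(4)[of "U i" "V i" "U j" "V j"]
          by (auto simp: transposes_up_iff intro: le_supI1)
        ultimately show "z \<in> set_of_fil (V i)" by (auto simp: less_eq_fil.rep_eq)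
      qed
    qed
  qed
  from covering_transposes_up[OF this] show "\<Sqinter>(U ` I) \<prec> \<Sqinter>(V ` I)"
    using cov i by simp
qed

text \<open>Zorn's lemma: by meet-continuity the supremum of a nonempty chain of such elements still
  meets \<open>v\<close> in \<open>u\<close>.\<close>

lemma maximal_relative_complement:
  fixes u v :: "'a::meet_continuous_lattice"
  assumes "u \<le> v"
  obtains k where "u \<le> k" "k \<sqinter> v = u" "\<And>e. k \<le> e \<Longrightarrow> e \<sqinter> v = u \<Longrightarrow> e = k"
proof -
  let ?A = "{k. k \<sqinter> v = u}"
  have "\<exists>m\<in>?A. \<forall>a\<in>?A. m \<le> a \<longrightarrow> a = m"
  proof (rule predicate_Zorn)
    show "partial_order_on ?A (relation_of (\<le>) ?A)"
      by (rule partial_order_on_relation_ofI) auto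
    fix C assume "C \<in> Chains (relation_of (\<le>) ?A)"
    then have C: "\<And>c. c \<in> C \<Longrightarrow> c \<sqinter> v = u" "\<And>c d. c \<in> C \<Longrightarrow> d \<in> C \<Longrightarrow> c \<le> d \<or> d \<le> c"
      by (auto simp: Chains_def relation_of_def)
    show "\<exists>b\<in>?A. \<forall>a\<in>C. a \<le> b"
    proof (cases "C = {}")
      case True
      then show ?thesis using assms by (intro bexI[of _ u]) (auto simp: inf.absorb1)
    next
      case False
      have "v \<sqinter> \<Squnion>C = (\<Squnion>c\<in>C. v \<sqinter> c)"
        using False C(2) by (intro meet_continuous) blast+
      also have "\<dots> = u" using C(1) False by (simp add: inf.commute)
      finally show ?thesis by (intro bexI[of _ "\<Squnion>C"]) (auto simp: inf.commute Sup_upper)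
    qed
  qed
  then obtain m where m: "m \<sqinter> v = u" "\<And>e. m \<le> e \<Longrightarrow> e \<sqinter> v = u \<Longrightarrow> e = m" by auto
  have "u \<le> m" using m(1) by (metis inf.cobounded1)
  then show thesis using m by (rule that)
qed

text \<open>It suffices that some \<open>(U j, V j)\<close> transposes up to the pair of suprema.
  The critical equation is the one for the meet; it follows once a single \<open>Fg k\<close> with
  \<open>V j \<sqinter> Fg k = U j\<close> bounds all \<open>U l\<close>.\<close>

lemma upper_regular_Fg:
  fixes x y :: "'a::{meet_continuous_lattice, modular_lattice}"
  assumes xy: "x \<prec> y"
    and bound: "\<And>T. finite T \<Longrightarrow> stack (Fg x) (Fg y) T \<Longrightarrow> card T \<le> n"
  shows "upper_regular (Fg x) (Fg y)"
  unfolding upper_regular_def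
proof (intro conjI allI impI, rule Fg_covering[OF xy], elim conjE)
  fix I :: "('a fil \<times> 'a fil) set" and r and U V :: "'a fil \<times> 'a fil \<Rightarrow> 'a fil"
  assume ne: "I \<noteq> {}" and lin: "linear_order_on I r"
    and cov: "\<forall>i\<in>I. U i \<prec> V i \<and> (U i, V i) \<approx> (Fg x, Fg y)"
    and up: "\<forall>i\<in>I. \<forall>j\<in>I. (i, j) \<in> r \<and> i \<noteq> j \<longrightarrow> (U i, V i) \<nearrow> (U j, V j)"
  have tot: "j = k \<or> (U j, V j) \<nearrow> (U k, V k) \<or> (U k, V k) \<nearrow> (U j, V j)" if "j \<in> I" "k \<in> I" for j k
    using lin up that by (metis linear_order_on_def total_on_def)
  \<comment> \<open>Sizes of stacks fitting below some \<open>U j\<close>; \<open>bound\<close> caps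
    them at \<open>n\<close>, so a greatest one exists.\<close>
  define Q where "Q m \<longleftrightarrow> (\<exists>T. \<exists>j\<in>I. finite T \<and> stack (Fg x) (Fg y) T \<and> card T = m \<and> (\<forall>p\<in>T. snd p \<le> U j))" for m
  obtain i where "i \<in> I" using ne by blast
  then have Q0: "Q 0" unfolding Q_def by (intro exI[of _ "{}"] bexI[of _ i]) (auto simp: stack_def)
  have Qn: "m \<le> n" if "Q m" for m
    using that bound unfolding Q_def by auto
  define m where "m = (GREATEST m. Q m)"
  have "Q m" unfolding m_def using Q0 Qn by (rule GreatestI_nat)
  have max: "m' \<le> m" if "Q m'" for m'
    unfolding m_def using that Qn by (rule Greatest_le_nat)
  from \<open>Q m\<close> obtain T j where T: "finite T" "stack (Fg x) (Fg y) T" "card T = m" "\<And>p. p \<in> T \<Longrightarrow> snd p \<le> U j"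
    and j: "j \<in> I" unfolding Q_def by blast
  have covj: "U j \<prec> V j" and prj: "(U j, V j) \<approx> (Fg x, Fg y)" using cov j by auto
  obtain u v where t: "(U j, V j) \<nearrow> (Fg u, Fg v)"
    using projective_Fg_transposes_up[OF covering_le[OF xy] prj] by blast
  have "u \<le> v" using transposes_up_le(2)[OF t] by (simp add: Fg_le_iff)
  then obtain k where k: "u \<le> k" "k \<sqinter> v = u" "\<And>e. k \<le> e \<Longrightarrow> e \<sqinter> v = u \<Longrightarrow> e = k"
    using maximal_relative_complement by blast
  have "(u, v) \<nearrow> (k, v \<squnion> k)" using k(2) by (intro transposes_upI) (auto simp: inf.commute)
  then have tk: "(U j, V j) \<nearrow> (Fg k, Fg (v \<squnion> k))"
    using transposes_up_trans[OF t] by (simp add: Fg_transposes_up_iff)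
  have Uk: "U l \<le> Fg k" if l: "l \<in> I" for l
    using tot[OF j l]
  proof (elim disjE)
    assume "j = l" then show ?thesis using transposes_up_le(3)[OF tk] by simp
  next
    assume "(U l, V l) \<nearrow> (U j, V j)"
    then show ?thesis using transposes_up_le(3)[OF tk] by (auto dest: transposes_up_le(3))
  next
    assume jl: "(U j, V j) \<nearrow> (U l, V l)"
    let ?K = "Fg k \<squnion> U l"
    have "\<not> V j \<le> ?K"
    proof
      \<comment> \<open>The extra covering lies above \<open>U j\<close>, hence on top of
        \<open>T\<close>, and below \<open>U l\<close>: a stack of size
        \<open>m + 1\<close>.\<close>
      assume "V j \<le> ?K"
      then obtain e f where ef: "U j \<le> e" "e \<prec> f" "f \<le> U l" "(e, f) \<approx> (U j, V j)"
        using extra_covering[OF covj tk jl] by blast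
      have pr: "(e, f) \<approx> (Fg x, Fg y)" using ef(4) prj by (rule projective_trans)
      have "snd p \<le> e" if "p \<in> T" for p using T(4)[OF that] ef(1) by simp
      note ins = stack_insert[OF T(2) ef(2) pr, OF disjI2, OF this]
      have "\<forall>p\<in>insert (e, f) T. snd p \<le> U l"
        using T(4) ef(3) transposes_up_le(3)[OF jl] by (auto intro: order_trans)
      then have "Q (card (insert (e, f) T))"
        unfolding Q_def using ins(1) l T(1) by blast
      then show False using max ins(2) T(1,3) by fastforce
    qed
    moreover have "U j \<le> ?K" using transposes_up_le(3)[OF jl] by (simp add: le_supI2)
    ultimately have VK: "V j \<sqinter> ?K = U j" using covj covering_inf_eq by blast
    \<comment> \<open>As \<open>Fg u \<squnion> V j = Fg v\<close>, this carries the meet equation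
      from \<open>V j\<close> up to \<open>Fg v\<close>.\<close>
    have "Fg u \<squnion> (V j \<sqinter> ?K) = (Fg u \<squnion> V j) \<sqinter> ?K"
      using k(1) by (intro modular_law le_supI1) (simp add: Fg_le_iff)
    then have "Fg v \<sqinter> ?K = Fg u"
      using VK t transposes_up_le(3)[OF t] by (simp add: transposes_up_iff sup.commute sup.absorb1)
    then have "u \<in> set_of_fil (Fg v \<sqinter> ?K)" by (simp add: Fg.rep_eq)
    \<comment> \<open>The join \<open>?K\<close> is an intersection, so \<open>e\<close> is above
      \<open>k\<close> and a member of \<open>U l\<close>. Maximality gives \<open>e = k\<close>,
      hence \<open>k\<close> is a member of \<open>U l\<close>.\<close>
    then obtain f e where fe: "v \<le> f" "e \<in> set_of_fil ?K" "f \<sqinter> e \<le> u"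
      by (auto simp: inf_fil.rep_eq Fg.rep_eq)
    then have ke: "k \<le> e" by (simp add: sup_fil.rep_eq Fg.rep_eq)
    have "e \<sqinter> v \<le> u" using fe by (meson inf.cobounded1 inf.cobounded2 le_infI order_trans)
    then have "e \<sqinter> v = u" using ke k(1) \<open>u \<le> v\<close> by (auto intro: antisym)
    then have "e = k" using k(3) ke by blast
    then show ?thesis using fe(2) by (simp add: sup_fil.rep_eq le_Fg_iff)
  qed
  have "(U j, V j) \<nearrow> (\<Squnion>(U ` I), \<Squnion>(V ` I))"
  proof (rule transposes_upI)
    have "V j \<sqinter> \<Squnion>(U ` I) \<le> V j \<sqinter> Fg k" using Uk by (intro inf_mono SUP_least) auto
    moreover have "V j \<sqinter> Fg k = U j" using tk by (simp add: transposes_up_iff)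
    moreover have "U j \<le> V j \<sqinter> \<Squnion>(U ` I)" using j covering_le[OF covj] by (auto intro: SUP_upper)
    ultimately show "V j \<sqinter> \<Squnion>(U ` I) = U j" by simp
    show "V j \<squnion> \<Squnion>(U ` I) = \<Squnion>(V ` I)"
    proof (rule antisym)
      have "\<Squnion>(U ` I) \<le> \<Squnion>(V ` I)" using cov covering_le by (intro SUP_mono) blast
      then show "V j \<squnion> \<Squnion>(U ` I) \<le> \<Squnion>(V ` I)" using j by (simp add: SUP_upper)
      show "\<Squnion>(V ` I) \<le> V j \<squnion> \<Squnion>(U ` I)"
      proof (rule SUP_least)
        fix l assume l: "l \<in> I"
        have "V l \<le> V j \<squnion> U l"
          using tot[OF j l] transposes_up_le(4)[of "U l" "V l" "U j" "V j"]
          by (auto simp: transposes_up_iff intro: le_supI1)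
        also have "\<dots> \<le> V j \<squnion> \<Squnion>(U ` I)" using l by (intro sup_mono SUP_upper) auto
        finally show "V l \<le> V j \<squnion> \<Squnion>(U ` I)" .
      qed
    qed
  qed
  from covering_transposes_up[OF this] show "\<Squnion>(U ` I) \<prec> \<Squnion>(V ` I)"
    using covj by simp
qed


section \<open>Locating a covering inside a maximal chain\<close>

section \<open>Maximal chains\<close>

lemma maximal_chain_linear:
  assumes "is_maximal_chain C" "c \<in> C" "d \<in> C"
  shows "c \<le> d \<or> d \<le> c"
  using assms by (auto simp: pred_on.maxchain_def pred_on.chain_def)

lemma maximal_chain_mem:
  assumes C: "is_maximal_chain C" and z: "\<And>c. c \<in> C \<Longrightarrow> c \<le> z \<or> z \<le> c"
  shows "z \<in> C"
proof (rule ccontr)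
  assume "z \<notin> C"
  moreover have "is_chain (insert z C)"
    using C z by (auto simp: pred_on.maxchain_def pred_on.chain_def)
  ultimately show False using C unfolding pred_on.maxchain_def by blast
qed

lemma maximal_chain_Sup:
  fixes C :: "'a::complete_lattice set"
  assumes C: "is_maximal_chain C" and D: "D \<subseteq> C"
  shows "\<Squnion>D \<in> C"
proof (rule maximal_chain_mem[OF C])
  fix c assume "c \<in> C"
  then show "c \<le> \<Squnion>D \<or> \<Squnion>D \<le> c"
    using maximal_chain_linear[OF C] D by (meson Sup_least Sup_upper2 subsetD)
qed

lemma maximal_chain_Inf:
  fixes C :: "'a::complete_lattice set"
  assumes C: "is_maximal_chain C" and D: "D \<subseteq> C"
  shows "\<Sqinter>D \<in> C"
proof (rule maximal_chain_mem[OF C])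
  fix c assume "c \<in> C"
  then show "c \<le> \<Sqinter>D \<or> \<Sqinter>D \<le> c"
    using maximal_chain_linear[OF C] D by (meson Inf_greatest Inf_lower2 subsetD)
qed

lemma chain_linear_order_on:
  assumes "\<And>c d. c \<in> C \<Longrightarrow> d \<in> C \<Longrightarrow> c \<le> d \<or> d \<le> (c :: 'a::order)"
  shows "linear_order_on C {(c, d). c \<in> C \<and> d \<in> C \<and> c \<le> d}"
  using assms
  by (auto simp: linear_order_on_def partial_order_on_def preorder_on_def refl_on_def trans_def
      antisym_def total_on_def)

text \<open>Split \<open>C\<close> by whether \<open>a \<squnion> c\<close> lies above
  \<open>b\<close>. Upper regularity shows that the supremum \<open>c\<close> of the lower part
  stays on its side, lower regularity does the same for the infimum \<open>d\<close> of the upper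
  part. Then \<open>(b \<sqinter> c, b \<sqinter> d)\<close> transposes up to both
  \<open>(c, d)\<close> and \<open>(a, b)\<close>.\<close>

lemma maximal_chain_covering:
  fixes a b x y :: "'a::{complete_lattice, modular_lattice}"
  assumes reg: "regular x y" and C: "is_maximal_chain C" and ab: "a \<prec> b" "(a, b) \<approx> (x, y)"
  obtains c d where "(c, d) \<in> coverings_in C x y" "d \<le> c \<squnion> b" "b \<le> a \<squnion> d" "\<not> b \<le> a \<squnion> c"
proof -
  define L where "L = {c \<in> C. \<not> b \<le> a \<squnion> c}"
  define R where "R = {c \<in> C. b \<le> a \<squnion> c}"
  define c where "c = \<Squnion>L"
  define d where "d = \<Sqinter>R"
  have LR: "L \<subseteq> C" "R \<subseteq> C" by (auto simp: L_def R_def)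
  have cd: "c \<in> C" "d \<in> C"
    using maximal_chain_Sup[OF C] maximal_chain_Inf[OF C] LR by (auto simp: c_def d_def)
  have linC: "p \<le> q \<or> q \<le> p" if "p \<in> C" "q \<in> C" for p q
    using maximal_chain_linear[OF C that] .
  have "\<bottom> \<in> C" "\<top> \<in> C" by (rule maximal_chain_mem[OF C]; simp)+
  then have neL: "L \<noteq> {}" and neR: "R \<noteq> {}"
    using ab by (auto simp: L_def R_def covering_def)
  have tL: "(a, b) \<nearrow> (a \<squnion> l, b \<squnion> l)" if "l \<in> L" for l
  proof (rule transposes_upI)
    show "b \<sqinter> (a \<squnion> l) = a" using that ab(1) by (intro covering_inf_eq) (auto simp: L_def)
    show "b \<squnion> (a \<squnion> l) = b \<squnion> l" using covering_le[OF ab(1)] by (simp add: sup.absorb1 flip: sup.assoc)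
  qed
  have tR: "(a \<sqinter> p, b \<sqinter> p) \<nearrow> (a, b)" if "p \<in> R" for p
  proof (rule transposes_upI)
    show "b \<sqinter> p \<sqinter> a = a \<sqinter> p" using covering_le[OF ab(1)] by (metis inf.absorb2 inf.assoc inf.commute)
    show "b \<sqinter> p \<squnion> a = b"
      using modular_law[OF covering_le[OF ab(1)], of p] that by (simp add: R_def ac_simps inf.absorb1)
  qed
  have "(\<Squnion>l\<in>L. a \<squnion> l) \<prec> (\<Squnion>l\<in>L. b \<squnion> l)"
  proof (rule upper_regularD[where r = "{(p, q). p \<in> L \<and> q \<in> L \<and> p \<le> q}"])
    show "upper_regular x y" using reg by (simp add: regular_def)
    show "linear_order_on L {(p, q). p \<in> L \<and> q \<in> L \<and> p \<le> q}"
      using linC LR by (intro chain_linear_order_on) blast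
    show "a \<squnion> l \<prec> b \<squnion> l \<and> (a \<squnion> l, b \<squnion> l) \<approx> (x, y)" if "l \<in> L" for l
      using tL[OF that] ab covering_transposes_up transposes_up_projective projective_sym projective_trans
      by meson
    show "(a \<squnion> l, b \<squnion> l) \<nearrow> (a \<squnion> m, b \<squnion> m)"
      if "l \<in> L" "m \<in> L" "(l, m) \<in> {(p, q). p \<in> L \<and> q \<in> L \<and> p \<le> q}" "l \<noteq> m" for l m
      using that by (intro transposes_up_factor[OF tL tL] sup_mono) auto
  qed (fact neL)
  moreover have "(\<Squnion>l\<in>L. e \<squnion> l) = e \<squnion> c" for e
    using neL by (simp add: c_def SUP_sup_distrib[symmetric])
  ultimately have "a \<squnion> c \<prec> b \<squnion> c" by simp
  then have bc: "\<not> b \<le> a \<squnion> c" by (auto simp: covering_def less_le_not_le)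
  have "(\<Sqinter>p\<in>R. a \<sqinter> p) \<prec> (\<Sqinter>p\<in>R. b \<sqinter> p)"
  \<comment> \<open>The order is reversed because lower regularity indexes descending
    families.\<close>
  proof (rule lower_regularD[where r = "{(p, q). p \<in> R \<and> q \<in> R \<and> p \<le> q}\<inverse>"])
    show "lower_regular x y" using reg by (simp add: regular_def)
    have "linear_order_on R {(p, q). p \<in> R \<and> q \<in> R \<and> p \<le> q}"
      using linC LR by (intro chain_linear_order_on) blast
    then show "linear_order_on R ({(p, q). p \<in> R \<and> q \<in> R \<and> p \<le> q}\<inverse>)" by simp
    show "a \<sqinter> p \<prec> b \<sqinter> p \<and> (a \<sqinter> p, b \<sqinter> p) \<approx> (x, y)" if "p \<in> R" for p
      using tR[OF that] ab covering_transposes_up transposes_up_projective projective_trans by meson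
    show "(a \<sqinter> q, b \<sqinter> q) \<nearrow> (a \<sqinter> p, b \<sqinter> p)"
      if "p \<in> R" "q \<in> R" "(p, q) \<in> {(p, q). p \<in> R \<and> q \<in> R \<and> p \<le> q}\<inverse>" "p \<noteq> q" for p q
    proof -
      have "q \<le> p" using that by simp
      then have "a \<sqinter> (b \<sqinter> p) = a \<sqinter> p" "b \<sqinter> q \<le> b \<sqinter> p"
        using covering_le[OF ab(1)] by (simp_all add: inf.absorb1 le_infI2 flip: inf.assoc)
      then show ?thesis
        using transposes_up_between(1)[OF tR[OF that(2)], of "b \<sqinter> p"] by simp
    qed
  qed (fact neR)
  moreover have "(\<Sqinter>p\<in>R. e \<sqinter> p) = e \<sqinter> d" for e
    using neR by (simp add: d_def INF_inf_distrib[symmetric])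
  ultimately have covd: "a \<sqinter> d \<prec> b \<sqinter> d" by simp
  have bd: "b \<le> a \<squnion> d"
  proof (rule ccontr)
    assume "\<not> b \<le> a \<squnion> d"
    then have "b \<sqinter> (a \<squnion> d) = a" by (intro covering_inf_eq[OF ab(1)]) auto
    then have "b \<sqinter> d \<le> a" by (metis inf_mono order_refl sup.cobounded2)
    then show False using covd by (auto simp: covering_def less_le_not_le)
  qed
  have "c < d"
    using linC[OF cd] bc bd by (metis less_le order_trans sup_mono order_refl)
  have ccd: "c \<prec> d"
    unfolding covering_def
  proof (intro conjI notI, fact)
    assume "\<exists>z. c < z \<and> z < d"
    then obtain z where z: "c < z" "z < d" by blast
    \<comment> \<open>Nothing in \<open>C\<close> lies strictly between, and a point strictly
      between would be comparable to all of \<open>C\<close>, hence in \<open>C\<close> by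
      maximality.\<close>
    have side: "p \<le> c \<or> d \<le> p" if "p \<in> C" for p
      using that by (cases "b \<le> a \<squnion> p") (auto simp: c_def d_def L_def R_def intro: Sup_upper Inf_lower)
    then have "z \<in> C" using z by (intro maximal_chain_mem[OF C]) (meson order_less_imp_le order_trans)
    then show False using side z by (metis leD)
  qed
  have "\<not> b \<sqinter> d \<le> c"
  proof
    assume "b \<sqinter> d \<le> c"
    have "b = a \<squnion> (d \<sqinter> b)" using modular_law[OF covering_le[OF ab(1)], of d] bd by (simp add: inf.absorb2)
    also have "\<dots> \<le> a \<squnion> c" using \<open>b \<sqinter> d \<le> c\<close> by (simp add: inf.commute le_supI2)
    finally show False using bc by simp
  qed
  have t1: "(b \<sqinter> c, b \<sqinter> d) \<nearrow> (c, d)"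
  proof (rule transposes_upI)
    show "b \<sqinter> d \<sqinter> c = b \<sqinter> c" using \<open>c < d\<close> by (simp add: inf.assoc inf.absorb2)
    have "b \<sqinter> d \<squnion> c \<noteq> c" using \<open>\<not> b \<sqinter> d \<le> c\<close> by (metis sup.cobounded1)
    then show "b \<sqinter> d \<squnion> c = d"
      using covering_cases[OF ccd, of "b \<sqinter> d \<squnion> c"] \<open>c < d\<close> by simp
  qed
  have "b \<sqinter> c \<le> a"
  proof -
    have "b \<sqinter> (a \<squnion> c) = a" using bc by (intro covering_inf_eq[OF ab(1)]) auto
    then show ?thesis by (metis inf_mono order_refl sup.cobounded2)
  qed
  then have le: "b \<sqinter> c \<le> a \<sqinter> d" using \<open>c < d\<close> by (simp add: le_infI2 order_less_imp_le)
  have "b \<sqinter> c \<prec> b \<sqinter> d" using covering_transposes_up[OF t1] ccd by simp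
  \<comment> \<open>As \<open>a \<sqinter> d\<close> lies in the covering interval and differs from
    its top, it equals the bottom, joining the two transpositions.\<close>
  then have "a \<sqinter> d = b \<sqinter> c \<or> a \<sqinter> d = b \<sqinter> d"
    using le covering_le[OF covd] by (rule covering_cases)
  then have eq: "b \<sqinter> c = a \<sqinter> d" using covd by (metis covering_def less_irrefl)
  have "b \<sqinter> d \<squnion> a = b"
    using modular_law[OF covering_le[OF ab(1)], of d] bd by (simp add: ac_simps inf.absorb1)
  moreover have "b \<sqinter> d \<sqinter> a = a \<sqinter> d" using covering_le[OF ab(1)] by (metis inf.absorb2 inf.assoc inf.commute)
  ultimately have t2: "(a \<sqinter> d, b \<sqinter> d) \<nearrow> (a, b)" by (intro transposes_upI)
  have "(c, d) \<approx> (x, y)"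
    using t1[unfolded eq] t2 ab(2) by (meson transposes_up_projective projective_sym projective_trans)
  then have "(c, d) \<in> coverings_in C x y" using cd ccd by (simp add: coverings_in_def)
  moreover have "d \<le> c \<squnion> b" using t1 unfolding transposes_up_iff
    by (metis inf.cobounded1 order_refl sup.commute sup_mono)
  ultimately show thesis using that bd bc by blast
qed

text \<open>The assignment is injective: if \<open>p\<close> lies below \<open>q\<close> and both
  are sent to \<open>(c, d)\<close>, then \<open>d \<le> c \<squnion> fst q\<close>, so
  \<open>snd q \<le> fst q \<squnion> d \<le> fst q \<squnion> c\<close>, a contradiction.\<close>

lemma stack_card_le_maximal_chain:
  fixes x y :: "'a::{complete_lattice, modular_lattice}"
  assumes reg: "regular x y" and C: "is_maximal_chain C" and T: "stack x y T"
    and fin: "finite (coverings_in C x y)"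
  shows "card T \<le> card (coverings_in C x y)"
proof -
  have "\<exists>q \<in> coverings_in C x y. snd q \<le> fst q \<squnion> snd p \<and> snd p \<le> fst p \<squnion> snd q \<and> \<not> snd p \<le> fst p \<squnion> fst q"
    if "p \<in> T" for p
    using maximal_chain_covering[OF reg C, of "fst p" "snd p"] that T unfolding stack_def
    by (metis prod.collapse fst_conv snd_conv)
  then obtain f where f: "\<And>p. p \<in> T \<Longrightarrow> f p \<in> coverings_in C x y"
    "\<And>p. p \<in> T \<Longrightarrow> snd (f p) \<le> fst (f p) \<squnion> snd p"
    "\<And>p. p \<in> T \<Longrightarrow> snd p \<le> fst p \<squnion> snd (f p)"
    "\<And>p. p \<in> T \<Longrightarrow> \<not> snd p \<le> fst p \<squnion> fst (f p)"
    by metis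
  have no: False if "p \<in> T" "q \<in> T" "snd p \<le> fst q" "f p = f q" for p q
  proof -
    have "snd (f q) \<le> fst (f q) \<squnion> snd p" using f(2)[OF that(1)] that(4) by simp
    also have "\<dots> \<le> fst (f q) \<squnion> fst q" using that(3) by (intro sup_mono order_refl)
    finally have "fst q \<squnion> snd (f q) \<le> fst q \<squnion> fst (f q)" by (simp add: sup.commute)
    then have "snd q \<le> fst q \<squnion> fst (f q)"
      using f(3)[OF that(2)] by (rule order_trans[rotated])
    then show False using f(4)[OF that(2)] by contradiction
  qed
  have "inj_on f T"
    using no T unfolding stack_def inj_on_def by metis
  then show ?thesis using f(1) fin by (auto intro: card_inj_on_le)
qed


section \<open>Finite upper bounds are attained, and the final count\<close>

section \<open>The multiplicity upper bound\<close>

lemma stack_le_mult_upper_bound: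
  fixes x y :: "'a::lattice"
  assumes "finite (Field (mult_upper_bound x y))" "stack x y T"
  shows "finite T" "card T \<le> card (Field (mult_upper_bound x y))"
proof -
  let ?\<nu> = "mult_upper_bound x y"
  obtain C where C: "is_chain C" "T \<subseteq> coverings_in C x y" using stack_in_chain[OF assms(2)] .
  have "|T| \<le>o |coverings_in C x y|" using C(2) by (rule card_of_mono1)
  also have "|coverings_in C x y| \<le>o ?\<nu>"
    using mult_upper_bound_bounds[of x y] C(1) by (auto simp: bounds_mult_def chain_mult_def)
  also have "?\<nu> =o |Field ?\<nu>|"
    using mult_upper_bound_bounds[of x y] by (auto simp: bounds_mult_def card_of_Field_ordIso ordIso_symmetric)
  finally have le: "|T| \<le>o |Field ?\<nu>|" .
  then show fin: "finite T" using assms(1) card_of_ordLeq_finite by blast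
  show "card T \<le> card (Field ?\<nu>)"
    using le assms(1) card_of_ordLeq[of T "Field ?\<nu>"] card_inj_on_le by blast
qed

text \<open>Otherwise every chain would carry fewer than \<open>?n\<close> coverings, and
  \<open>?n - 1\<close> would be a smaller bound.\<close>

lemma mult_upper_bound_attained:
  fixes x y :: "'a::lattice"
  assumes fin: "finite (Field (mult_upper_bound x y))"
  obtains T where "finite T" "stack x y T" "card T = card (Field (mult_upper_bound x y))"
proof -
  let ?\<nu> = "mult_upper_bound x y"
  let ?n = "card (Field ?\<nu>)"
  have "\<exists>T. stack x y T \<and> card T = ?n"
  proof (rule ccontr)
    assume none: "\<nexists>T. stack x y T \<and> card T = ?n"
    have lt: "finite T" "card T < ?n" if "stack x y T" for T
      using stack_le_mult_upper_bound[OF fin that] none that by (auto simp: le_less)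
    have "stack x y {}" by (simp add: stack_def)
    \<comment> \<open>Positivity makes the truncated \<open>?n - 1\<close> really smaller than
      \<open>?n\<close>.\<close>
    then have pos: "0 < ?n" using lt(2) by fastforce
    have "chain_mult C x y \<le>o |{..<?n - 1}|" if "is_chain C" for C
    proof -
      have "card (coverings_in C x y) \<le> card {..<?n - 1}"
        using lt(2)[OF stack_coverings_in[OF that, of x y]] by simp
      from card_le_inj[OF lt(1)[OF stack_coverings_in[OF that]] finite_lessThan this]
      show ?thesis
        unfolding chain_mult_def card_of_ordLeq[symmetric] by (simp add: conj_commute)
    qed
    then have "bounds_mult |{..<?n - 1}| x y"
      by (simp add: bounds_mult_def card_of_Card_order)
    \<comment> \<open>The competing cardinal lives on the naturals, so leastness across types is
      used.\<close>
    then have "?\<nu> \<le>o |{..<?n - 1}|" by (rule mult_upper_bound_least)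
    then have "|Field ?\<nu>| \<le>o |{..<?n - 1}|"
      using card_of_mono2[of ?\<nu> "|{..<?n - 1}|"] by (simp add: Field_card_of)
    then have "?n \<le> ?n - 1"
      unfolding card_of_ordLeq[symmetric] using card_inj_on_le[of _ _ "{..<?n - 1}"] by auto
    then show False using pos by simp
  qed
  then show thesis using that stack_le_mult_upper_bound(1)[OF fin] by blast
qed

theorem theorem31:
  fixes x y :: "'a::{meet_continuous_lattice, modular_lattice}"
  assumes "x \<prec> y"
    and "finite (Field (mult_upper_bound x y))"
  shows "regular (Fg x) (Fg y) \<and> has_multiplicity (Fg x) (Fg y) (mult_upper_bound x y)"
proof
  let ?\<nu> = "mult_upper_bound x y"
  let ?n = "card (Field ?\<nu>)"
  have bound: "card T \<le> ?n" if "finite T" "stack (Fg x) (Fg y) T" for T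
    using stack_of_filters[OF assms(1) that] stack_le_mult_upper_bound(2)[OF assms(2)] by metis
  show reg: "regular (Fg x) (Fg y)"
    unfolding regular_def
    using upper_regular_Fg[OF assms(1) bound] lower_regular_fil[OF Fg_covering[OF assms(1)]] by blast
  show "has_multiplicity (Fg x) (Fg y) ?\<nu>"
    unfolding has_multiplicity_def
  proof (intro allI impI)
    fix C :: "'a fil set" assume C: "is_maximal_chain C"
    let ?S = "coverings_in C (Fg x) (Fg y)"
    have S: "stack (Fg x) (Fg y) ?S"
      using C by (intro stack_coverings_in) (simp add: pred_on.maxchain_def)
    \<comment> \<open>\<open>bound\<close> speaks of finite stacks only, so an infinite one is
      refuted through a subset of size \<open>?n + 1\<close>.\<close>
    have fin: "finite ?S"
    proof (rule ccontr)
      assume "infinite ?S"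
      then obtain T where "T \<subseteq> ?S" "finite T" "card T = Suc ?n"
        using infinite_arbitrarily_large by metis
      then show False using bound[of T] stack_subset[OF S] by simp
    qed
    \<comment> \<open>For the lower bound, an optimal stack of the original lattice is embedded by
      \<open>Fg\<close> and counted inside \<open>C\<close>.\<close>
    obtain T where T: "stack x y T" "card T = ?n" using mult_upper_bound_attained[OF assms(2)] .
    have "inj_on (map_prod Fg Fg) T" by (auto simp: inj_on_def Fg_inj)
    then have "?n = card (map_prod Fg Fg ` T)" using T(2) by (simp add: card_image)
    also have "\<dots> \<le> card ?S" by (rule stack_card_le_maximal_chain[OF reg C stack_Fg[OF T(1)] fin])
    finally have "card ?S = ?n" using bound[OF fin S] by simp
    then have "|?S| =o |Field ?\<nu>|"
      unfolding card_of_ordIso[symmetric] by (rule finite_same_card_bij[OF fin assms(2)])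
    also have "|Field ?\<nu>| =o ?\<nu>"
      using mult_upper_bound_bounds[of x y] by (simp add: bounds_mult_def card_of_Field_ordIso)
    finally show "chain_mult C (Fg x) (Fg y) =o ?\<nu>" by (simp add: chain_mult_def)
  qed
qed

end
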